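(* Let $\mathcal{H}$ be an infinite-dimensional separable real Hilbert space with a given Hilbert (orthonormal) basis $(e_n)_{n\ge 1}$. For all real numbers $0<c_1<c_2$ there exist real numbers $M>K>1$ such that, for the sequence $\varepsilon_m=M/K^{m-1}$ ($m\ge 1$), which satisfies $\varepsilon_m\searrow 0$, and the associated bounded weighted shift $W_\varepsilon\in\mathcal{L}(\mathcal{H})$ (defined in the context), there is a map $N:\mathcal{H}\to\mathcal{H}$ with $N(0)=0$ for which the map $T:\mathcal{H}\to\mathcal{H}$, $T(x)=W_\varepsilon x+N(x)$, has the following properties: (i) $T$ is of class $\mathcal{C}^1$ on $\mathcal{H}$ in the sense of Fréchet; (ii) $\|N(x)\|/\|x\|\to 0$ as $x\to 0$; (iii) the spectral radius of $W_\varepsilon$ is larger than one; (iv) the fixed point $x=0$ of $T$ is exponentially asymptotically stable; (v) as $x\to 0$, that is, for all $x\ne 0$ with $\|x\|$ sufficiently small, $$\left(\frac{1}{-\log\|x\|}\right)^{c_2}<\frac{\|N(x)\|}{\|x\|}<4\left(\frac{1}{-\log\|x\|}\right)^{c_1}.$$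
   Context: $\mathcal{L}(\mathcal{H})$ denotes the bounded linear operators on $\mathcal{H}$. Weighted shift: a bounded linear operator $W$ on $\mathcal{H}$ with $We_n=\alpha_n e_{n+1}$ for all $n\ge 1$, for some bounded real sequence $(\alpha_n)_{n\ge 1}$. The operator $W_\varepsilon$ (Kakutani's construction): let $(\varepsilon_m)_{m\ge 1}$ be a strictly decreasing sequence of positive real numbers converging to $0$. Every integer $n\ge 1$ is written uniquely as $n=2^{k}(2\ell+1)$ with integers $k,\ell\ge 0$; put $k(n)=k$ and $\alpha_n=\varepsilon_{1+k(n)}$. Then $W_\varepsilon$ is the weighted shift $W_\varepsilon e_n=\alpha_n e_{n+1}$, $n\ge 1$. Exponential asymptotic stability of $x=0$ as a fixed point of $T$: there exists $\lambda<1$ such that for every $\eta>0$ there is $\delta(\eta)>0$ such that $\|x_0\|<\delta(\eta)$ implies $\|T^n(x_0)\|\le \eta\lambda^n$ for all $n\ge 0$. $\log$ is the natural logarithm. *)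

theory Defs
  imports "HOL-Analysis.Analysis" "HOL-Computational_Algebra.Primes"
begin

text \<open>
  Sequences are indexed by the integers \<open>n \<ge> 1\<close>: the value at \<open>0\<close> of a sequence of type
  \<open>nat \<Rightarrow> _\<close> is irrelevant throughout.
\<close>

text \<open>
  A Hilbert space is a type of sort \<open>{real_inner, complete_space}\<close>. The existence of a Hilbert
  basis indexed by the positive integers makes it separable and infinite-dimensional.
\<close>

definition hilbert_basis :: "(nat \<Rightarrow> 'a::real_inner) \<Rightarrow> bool" where
  "hilbert_basis e \<longleftrightarrow>
     (\<forall>m\<ge>1. \<forall>n\<ge>1. inner (e m) (e n) = (if m = n then 1 else 0)) \<and>
     closure (span (e ` {1..})) = UNIV"

definition weighted_shift ::
  "(nat \<Rightarrow> 'a::real_inner) \<Rightarrow> (nat \<Rightarrow> real) \<Rightarrow> ('a \<Rightarrow>\<^sub>L 'a) \<Rightarrow> bool" where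
  "weighted_shift e \<alpha> W \<longleftrightarrow>
     bounded (\<alpha> ` {1..}) \<and> (\<forall>n\<ge>1. blinfun_apply W (e n) = \<alpha> n *\<^sub>R e (n + 1))"

definition dyadic_exponent :: "nat \<Rightarrow> nat" where
  "dyadic_exponent n = (THE k. \<exists>l. n = 2 ^ k * (2 * l + 1))"

lemma dyadic_exponent_eqI:
  assumes "n = 2 ^ k * (2 * l + 1)"
  shows "dyadic_exponent n = k"
proof -
  have *: "multiplicity 2 n = j" if "n = 2 ^ j * (2 * i + 1)" for i j :: nat
  proof (rule multiplicity_eqI)
    show "2 ^ j dvd n"
      using that by simp
    show "\<not> 2 ^ Suc j dvd n"
      unfolding that power_Suc2
      using dvd_times_left_cancel_iff[of "2 ^ j" 2 "2 * i + 1"] by simp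
  qed
  show ?thesis
    unfolding dyadic_exponent_def
  proof (rule the_equality)
    show "\<exists>l. n = 2 ^ k * (2 * l + 1)"
      using assms by blast
    show "j = k" if "\<exists>l. n = 2 ^ j * (2 * l + 1)" for j
    proof -
      from that obtain i where "n = 2 ^ j * (2 * i + 1)" ..
      then show "j = k"
        using *[of j i] *[OF assms] by simp
    qed
  qed
qed

lemma dyadic_exponent_eq_multiplicity:
  assumes "n \<ge> 1"
  shows "dyadic_exponent n = multiplicity 2 n"
proof -
  obtain m where m: "n = 2 ^ multiplicity 2 n * m" "\<not> 2 dvd m"
    using multiplicity_decompose'[of n 2] assms by auto
  from m(2) obtain l where "m = 2 * l + 1"
    by (rule oddE)
  with m(1) have "n = 2 ^ multiplicity 2 n * (2 * l + 1)"
    by simp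
  then show ?thesis
    by (rule dyadic_exponent_eqI)
qed

definition kakutani_weights :: "(nat \<Rightarrow> real) \<Rightarrow> nat \<Rightarrow> real" where
  "kakutani_weights \<epsilon> n = \<epsilon> (1 + dyadic_exponent n)"

definition strictly_decreasing_to_zero :: "(nat \<Rightarrow> real) \<Rightarrow> bool" where
  "strictly_decreasing_to_zero \<epsilon> \<longleftrightarrow>
     (\<forall>m\<ge>1. 0 < \<epsilon> m) \<and> (\<forall>m\<ge>1. \<epsilon> (m + 1) < \<epsilon> m) \<and> \<epsilon> \<longlonglongrightarrow> 0"

text \<open>
  The spectrum of an operator on a real space is that of its complexification. The pair
  \<open>(x, y)\<close> represents \<open>x + i y\<close>; the product norm on pairs is the Hilbert norm of the
  complexified space.
\<close>

definition complexification ::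
  "('a::real_normed_vector \<Rightarrow>\<^sub>L 'a) \<Rightarrow> 'a \<times> 'a \<Rightarrow> 'a \<times> 'a" where
  "complexification A = (\<lambda>(x, y). (blinfun_apply A x, blinfun_apply A y))"

definition complex_scale :: "complex \<Rightarrow> 'a::real_normed_vector \<times> 'a \<Rightarrow> 'a \<times> 'a" where
  "complex_scale z = (\<lambda>(x, y). (Re z *\<^sub>R x - Im z *\<^sub>R y, Re z *\<^sub>R y + Im z *\<^sub>R x))"

text \<open>
  An inverse of a complex-linear map is automatically complex-linear, so it suffices to ask
  for a (real-)bounded-linear inverse.
\<close>

definition spectrum :: "('a::real_normed_vector \<Rightarrow>\<^sub>L 'a) \<Rightarrow> complex set" where
  "spectrum A = {z. \<not> (\<exists>R. bounded_linear R \<and>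
     (\<forall>u. R (complexification A u - complex_scale z u) = u) \<and>
     (\<forall>u. complexification A (R u) - complex_scale z (R u) = u))}"

text \<open>
  On a nontrivial Banach space the spectrum is nonempty and bounded, so that the supremum
  below is meaningful.
\<close>

definition spectral_radius :: "('a::real_normed_vector \<Rightarrow>\<^sub>L 'a) \<Rightarrow> real" where
  "spectral_radius A = (SUP z\<in>spectrum A. cmod z)"

definition C1_frechet :: "('a::real_normed_vector \<Rightarrow> 'b::real_normed_vector) \<Rightarrow> bool" where
  "C1_frechet f \<longleftrightarrow>
     (\<exists>f' :: 'a \<Rightarrow> 'a \<Rightarrow>\<^sub>L 'b.
        (\<forall>x. (f has_derivative blinfun_apply (f' x)) (at x)) \<and> continuous_on UNIV f')"

definition exp_asymp_stable_at_0 :: "('a::real_normed_vector \<Rightarrow> 'a) \<Rightarrow> bool" where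
  "exp_asymp_stable_at_0 T \<longleftrightarrow> T 0 = 0 \<and>
     (\<exists>q<1. \<forall>\<eta>>0. \<exists>\<delta>>0. \<forall>x\<^sub>0. norm x\<^sub>0 < \<delta> \<longrightarrow>
        (\<forall>n. norm ((T ^^ n) x\<^sub>0) \<le> \<eta> * q ^ n))"

end

theory Submission
  imports Defs
begin

text \<open>
  With \<open>c\<^sub>1 < c < c\<^sub>2\<close>, \<open>K = 4 powr c\<close> and \<open>M = 2 * K\<close>, the perturbation \<open>N\<close> is minus a weighted shift
  whose weights depend on \<open>s = - ln (norm x)\<close>: all of them are comparable to \<open>s powr - c\<close>, which
  gives (v), and on the window \<open>[A k, B k]\<close> of values of \<open>s\<close> the weights at the indices of dyadic
  exponent \<open>k\<close> equal \<open>M / K ^ k\<close>, so that \<open>T\<close> has weight \<open>0\<close> there. Every \<open>2 ^ Suc k\<close> consecutive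
  indices contain one of exponent \<open>k\<close>; hence an orbit that stays in the window for that many
  steps is annihilated. The windows have length of order \<open>4 ^ k\<close>, whereas the norm grows by a factor
  of at most \<open>M\<close> per step; so an orbit that starts with norm at most \<open>exp (- Q * 4 ^ k)\<close> can only
  leave the window downwards, and within \<open>2 ^ Suc k\<close> steps it reaches a norm of at most
  \<open>exp (- Q * 4 ^ Suc k)\<close>. Consecutive windows overlap, so that this can be iterated over \<open>k\<close>.
  For the spectral radius, \<open>W x - (M / K) *\<^sub>R x = e 1\<close> has only one formal solution, and its
  coordinates do not tend to \<open>0\<close>.
\<close>

subsection \<open>Weighted shifts over an orthonormal basis\<close>

locale orthonormal_basis =
  fixes f :: "nat \<Rightarrow> 'a::{real_inner, complete_space}"
  assumes inner_f: "inner (f m) (f n) = (if m = n then 1 else 0)"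
    and dense: "closure (span (range f)) = UNIV"
begin

section \<open>Coordinates: Bessel, Riesz-Fischer and Parseval\<close>

lemma inner_sum_f:
  assumes "finite I"
  shows "inner (\<Sum>k\<in>I. c k *\<^sub>R f k) (f j) = (if j \<in> I then c j else 0)"
proof -
  have "inner (\<Sum>k\<in>I. c k *\<^sub>R f k) (f j) = (\<Sum>k\<in>I. if k = j then c k else 0)"
    by (auto simp: inner_sum_left inner_f intro!: sum.cong)
  then show ?thesis
    using assms by (simp add: sum.delta')
qed

lemma norm_sum_f_sq:
  assumes "finite I"
  shows "(norm (\<Sum>k\<in>I. c k *\<^sub>R f k))\<^sup>2 = (\<Sum>k\<in>I. (c k)\<^sup>2)"
proof -
  let ?s = "\<Sum>k\<in>I. c k *\<^sub>R f k"
  have "inner ?s ?s = (\<Sum>j\<in>I. c j * inner ?s (f j))"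
    by (simp add: inner_sum_right)
  also have "\<dots> = (\<Sum>k\<in>I. (c k)\<^sup>2)"
    by (intro sum.cong) (auto simp: inner_sum_f[OF assms] power2_eq_square)
  finally show ?thesis
    by (simp add: power2_norm_eq_inner)
qed

lemma bessel: "(\<Sum>k<n. (inner x (f k))\<^sup>2) \<le> (norm x)\<^sup>2"
proof -
  let ?s = "\<Sum>k<n. inner x (f k) *\<^sub>R f k"
  have 1: "inner x ?s = (\<Sum>k<n. (inner x (f k))\<^sup>2)"
    by (simp add: inner_sum_right power2_eq_square)
  have 2: "inner ?s ?s = (\<Sum>k<n. (inner x (f k))\<^sup>2)"
    using norm_sum_f_sq[of "{..<n}" "\<lambda>k. inner x (f k)"] by (simp add: power2_norm_eq_inner)
  have "0 \<le> inner (x - ?s) (x - ?s)"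
    by simp
  also have "\<dots> = inner x x - 2 * inner x ?s + inner ?s ?s"
    by (simp add: inner_diff_left inner_diff_right inner_commute)
  finally show ?thesis
    using 1 2 by (simp add: power2_norm_eq_inner)
qed

text \<open>The vectors orthogonal to \<open>x - y\<close> form a closed subspace containing every
  \<open>f k\<close>, hence by density everything, including \<open>x - y\<close> itself.\<close>

lemma eq_by_coordinates:
  assumes "\<And>k. inner x (f k) = inner y (f k)"
  shows "x = y"
proof -
  let ?Z = "{v. inner (x - y) v = 0}"
  have "subspace ?Z"
    by (auto simp: subspace_def inner_add_right)
  moreover have "range f \<subseteq> ?Z"
    using assms by (auto simp: inner_diff_left)
  ultimately have "span (range f) \<subseteq> ?Z"
    by (rule span_minimal[rotated])
  moreover have "closed ?Z"
    by (intro closed_Collect_eq continuous_intros)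
  ultimately have "closure (span (range f)) \<subseteq> ?Z"
    by (rule closure_minimal)
  then have "x - y \<in> ?Z"
    unfolding dense by blast
  then show ?thesis
    by simp
qed

text \<open>Riesz-Fischer: the squared norm of a block of the series is a block of the sum of
  squares, so the partial sums are Cauchy and completeness gives the limit.\<close>

lemma synthesis:
  assumes c: "summable (\<lambda>k. (c k)\<^sup>2)"
  shows "\<exists>y. (\<lambda>n. \<Sum>k<n. c k *\<^sub>R f k) \<longlonglongrightarrow> y \<and> (\<forall>j. inner y (f j) = c j)"
proof -
  let ?s = "\<lambda>n. \<Sum>k<n. c k *\<^sub>R f k"
  have "Cauchy ?s"
  proof (rule CauchyI')
    fix d :: real
    assume "d > 0"
    then have "\<exists>N. \<forall>m\<ge>N. \<forall>n. norm (\<Sum>k\<in>{m..<n}. (c k)\<^sup>2) < d\<^sup>2"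
      using c unfolding summable_Cauchy by (meson zero_less_power)
    then obtain N where N: "\<And>m n. m \<ge> N \<Longrightarrow> norm (\<Sum>k\<in>{m..<n}. (c k)\<^sup>2) < d\<^sup>2"
      by blast
    have "norm (?s m - ?s n) < d" if "m \<ge> N" "n > m" for m n
    proof -
      have "?s n - ?s m = (\<Sum>k\<in>{m..<n}. c k *\<^sub>R f k)"
        using that by (simp add: sum_diff_nat_ivl lessThan_atLeast0)
      then have "(norm (?s m - ?s n))\<^sup>2 = (\<Sum>k\<in>{m..<n}. (c k)\<^sup>2)"
        by (simp add: norm_minus_commute[of "?s m"] norm_sum_f_sq)
      also have "\<dots> < d\<^sup>2"
        using N[OF that(1), of n] by (simp only: real_norm_def abs_less_iff)
      finally show ?thesis
        using \<open>d > 0\<close> by (auto intro!: power2_less_imp_less[of _ d])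
    qed
    then show "\<exists>M. \<forall>m\<ge>M. \<forall>n>m. dist (?s m) (?s n) < d"
      unfolding dist_norm by blast
  qed
  then obtain y where y: "?s \<longlonglongrightarrow> y"
    by (auto simp: Cauchy_convergent_iff convergent_def)
  have "inner y (f j) = c j" for j
  proof -
    have "(\<lambda>n. inner (?s n) (f j)) \<longlonglongrightarrow> inner y (f j)"
      using y by (intro tendsto_intros)
    moreover have "\<forall>\<^sub>F n in sequentially. inner (?s n) (f j) = c j"
      using eventually_gt_at_top[of j] by eventually_elim (simp add: inner_sum_f)
    ultimately show ?thesis
      using LIMSEQ_unique[OF _ tendsto_eventually] by metis
  qed
  with y show ?thesis
    by blast
qed

text \<open>Bessel makes the coordinates square-summable; the vector synthesized from them has the
  coordinates of \<open>x\<close>, hence is \<open>x\<close>, and the norms of the partial sums pass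
  to the limit.\<close>

lemma parseval: "(\<lambda>k. (inner x (f k))\<^sup>2) sums (norm x)\<^sup>2"
proof -
  have "summable (\<lambda>k. (inner x (f k))\<^sup>2)"
    by (rule summableI_nonneg_bounded[where x = "(norm x)\<^sup>2"]) (auto intro: bessel)
  then obtain y where y: "(\<lambda>n. \<Sum>k<n. inner x (f k) *\<^sub>R f k) \<longlonglongrightarrow> y"
    and "\<And>j. inner y (f j) = inner x (f j)"
    using synthesis[of "\<lambda>k. inner x (f k)"] by blast
  then have "y = x"
    by (intro eq_by_coordinates)
  with y have "(\<lambda>n. (norm (\<Sum>k<n. inner x (f k) *\<^sub>R f k))\<^sup>2) \<longlonglongrightarrow> (norm x)\<^sup>2"
    by (auto intro!: tendsto_intros)
  then show ?thesis
    by (simp add: norm_sum_f_sq sums_def)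
qed

text \<open>Prescribing coordinates rather than a series reduces identities between shifts to
  identities between weights. For bounded weights \<open>THE\<close> and \<open>Blinfun\<close> are
  faithful, as \<open>inner_wshift_0\<close> and \<open>inner_wshift_Suc\<close> show.\<close>

definition wshift :: "(nat \<Rightarrow> real) \<Rightarrow> 'a \<Rightarrow>\<^sub>L 'a" where
  "wshift a = Blinfun (\<lambda>x. THE y. inner y (f 0) = 0 \<and>
     (\<forall>k. inner y (f (Suc k)) = a k * inner x (f k)))"

text \<open>Parseval, compared term by term. It speaks of two vectors instead of
  \<open>wshift a\<close> because it serves to prove \<open>wshift\<close> well defined, and again
  for the nonlinear \<open>T\<close>, whose weights depend on \<open>x\<close>.\<close>

lemma norm_shift_le:
  assumes "inner y (f 0) = 0" "\<And>k. inner y (f (Suc k)) = a k * inner x (f k)"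
    and "\<And>k. \<bar>a k\<bar> \<le> C"
  shows "norm y \<le> C * norm x"
proof -
  have C: "0 \<le> C"
    using assms(3)[of 0] by linarith
  have y: "(\<lambda>k. (inner y (f (Suc k)))\<^sup>2) sums (norm y)\<^sup>2"
    using parseval[of y] assms(1) sums_Suc_iff[of "\<lambda>k. (inner y (f k))\<^sup>2"] by simp
  have x: "(\<lambda>k. C\<^sup>2 * (inner x (f k))\<^sup>2) sums (C\<^sup>2 * (norm x)\<^sup>2)"
    by (intro sums_mult parseval)
  have le: "(inner y (f (Suc k)))\<^sup>2 \<le> C\<^sup>2 * (inner x (f k))\<^sup>2" for k
    unfolding assms(2) power_mult_distrib
    by (intro mult_right_mono abs_le_square_iff[THEN iffD1]) (use assms(3)[of k] C in auto)
  have "(norm y)\<^sup>2 \<le> C\<^sup>2 * (norm x)\<^sup>2"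
    by (rule sums_le[OF le y x])
  then show ?thesis
    using C by (intro power2_le_imp_le[of "norm y" "C * norm x"]) (simp_all add: power_mult_distrib)
qed

lemma norm_shift_ge:
  assumes "inner y (f 0) = 0" "\<And>k. inner y (f (Suc k)) = a k * inner x (f k)"
    and "\<And>k. C \<le> \<bar>a k\<bar>" "0 \<le> C"
  shows "C * norm x \<le> norm y"
proof -
  have y: "(\<lambda>k. (inner y (f (Suc k)))\<^sup>2) sums (norm y)\<^sup>2"
    using parseval[of y] assms(1) sums_Suc_iff[of "\<lambda>k. (inner y (f k))\<^sup>2"] by simp
  have x: "(\<lambda>k. C\<^sup>2 * (inner x (f k))\<^sup>2) sums (C\<^sup>2 * (norm x)\<^sup>2)"
    by (intro sums_mult parseval)
  have le: "C\<^sup>2 * (inner x (f k))\<^sup>2 \<le> (inner y (f (Suc k)))\<^sup>2" for k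
    unfolding assms(2) power_mult_distrib
    by (intro mult_right_mono abs_le_square_iff[THEN iffD1]) (use assms(3)[of k] assms(4) in auto)
  have "C\<^sup>2 * (norm x)\<^sup>2 \<le> (norm y)\<^sup>2"
    by (rule sums_le[OF le x y])
  then show ?thesis
    by (intro power2_le_imp_le[of "C * norm x" "norm y"]) (simp_all add: power_mult_distrib)
qed

text \<open>\<open>synthesis\<close> supplies an image for each \<open>x\<close>,
  \<open>eq_by_coordinates\<close> makes it unique, and uniqueness yields linearity. With the bound
  from \<open>norm_shift_le\<close> the resulting map is bounded linear, so \<open>Blinfun\<close>
  represents it correctly.\<close>

lemma
  assumes a: "bounded (range a)"
  shows inner_wshift_0: "inner (wshift a x) (f 0) = 0"
    and inner_wshift_Suc: "inner (wshift a x) (f (Suc k)) = a k * inner x (f k)"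
proof -
  obtain C where C: "\<And>k. \<bar>a k\<bar> \<le> C"
    using a by (auto simp: bounded_iff)
  let ?P = "\<lambda>x y. inner y (f 0) = 0 \<and> (\<forall>k. inner y (f (Suc k)) = a k * inner x (f k))"
  have ex: "\<exists>y. ?P x y" for x
  proof -
    let ?c = "case_nat 0 (\<lambda>k. a k * inner x (f k))"
    have "summable (\<lambda>k. (?c (Suc k))\<^sup>2)"
    proof (rule summable_comparison_test')
      show "summable (\<lambda>k. C\<^sup>2 * (inner x (f k))\<^sup>2)"
        using parseval[of x] by (intro summable_mult) (rule sums_summable)
      show "norm ((?c (Suc k))\<^sup>2) \<le> C\<^sup>2 * (inner x (f k))\<^sup>2" for k
        using C[of k]
        by (auto simp: power_mult_distrib intro!: mult_right_mono abs_le_square_iff[THEN iffD1])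
    qed
    then have "summable (\<lambda>k. (?c k)\<^sup>2)"
      by (subst (asm) summable_Suc_iff)
    then obtain y where "\<And>j. inner y (f j) = ?c j"
      using synthesis[of ?c] by blast
    then have "?P x y"
      by simp
    then show ?thesis ..
  qed
  have uniq: "y = z" if "?P x y" "?P x z" for y x z
  proof (rule eq_by_coordinates)
    show "inner y (f k) = inner z (f k)" for k
      using that by (cases k) auto
  qed
  define h where "h = (\<lambda>x. THE y. ?P x y)"
  have h: "?P x (h x)" for x
    unfolding h_def by (rule theI') (use ex uniq in blast)
  have "bounded_linear h"
  proof (rule bounded_linear_intro)
    show "h (x + y) = h x + h y" for x y
      using h[of "x + y"] h[of x] h[of y]
      by (intro uniq[of "h (x + y)" "x + y"]) (simp_all add: inner_add_left ring_distribs)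
    show "h (r *\<^sub>R x) = r *\<^sub>R h x" for r x
      using h[of "r *\<^sub>R x"] h[of x]
      by (intro uniq[of "h (r *\<^sub>R x)" "r *\<^sub>R x"]) simp_all
    show "norm (h x) \<le> norm x * C" for x
      unfolding mult.commute[of _ C] by (rule norm_shift_le[of "h x" a]) (use h C in auto)
  qed
  then have "wshift a x = h x"
    unfolding wshift_def h_def by (simp add: bounded_linear_Blinfun_apply)
  then show "inner (wshift a x) (f 0) = 0" "inner (wshift a x) (f (Suc k)) = a k * inner x (f k)"
    using h[of x] by auto
qed

lemma bounded_weights: "(\<And>k. \<bar>a k\<bar> \<le> C) \<Longrightarrow> bounded (range (a :: nat \<Rightarrow> real))"
  by (auto simp: bounded_iff)

lemma norm_wshift_apply_le:
  assumes "\<And>k. \<bar>a k\<bar> \<le> C"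
  shows "norm (wshift a x) \<le> C * norm x"
proof -
  have b: "bounded (range a)"
    using assms by (rule bounded_weights)
  show ?thesis
    by (rule norm_shift_le[OF inner_wshift_0[OF b] inner_wshift_Suc[OF b] assms])
qed

lemma norm_wshift_apply_ge:
  assumes "bounded (range a)" "\<And>k. C \<le> \<bar>a k\<bar>" "0 \<le> C"
  shows "C * norm x \<le> norm (wshift a x)"
  by (rule norm_shift_ge[OF inner_wshift_0[OF assms(1)] inner_wshift_Suc[OF assms(1)] assms(2,3)])

lemma norm_wshift_le:
  assumes "\<And>k. \<bar>a k\<bar> \<le> C"
  shows "norm (wshift a) \<le> C"
proof (rule norm_blinfun_bound)
  show "0 \<le> C"
    using assms[of 0] by linarith
qed (use assms in \<open>rule norm_wshift_apply_le\<close>)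

lemma wshift_diff:
  assumes "bounded (range a)" "bounded (range b)"
  shows "wshift (\<lambda>k. a k - b k) = wshift a - wshift b"
proof (rule blinfun_eqI, rule eq_by_coordinates)
  fix x k
  have "bounded (range (\<lambda>k. a k - b k))"
    using bounded_minus_comp[OF assms] by simp
  then show "inner (wshift (\<lambda>k. a k - b k) x) (f k) = inner ((wshift a - wshift b) x) (f k)"
    using assms
    by (cases k) (auto simp: inner_wshift_0 inner_wshift_Suc blinfun.diff_left inner_diff_left algebra_simps)
qed

lemma wshift_scaleR:
  assumes "bounded (range a)"
  shows "wshift (\<lambda>k. r * a k) = r *\<^sub>R wshift a"
proof (rule blinfun_eqI, rule eq_by_coordinates)
  fix x k
  have "bounded (range (\<lambda>k. r * a k))"
    using bounded_scaleR_comp[OF assms, of r] by simp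
  then show "inner (wshift (\<lambda>k. r * a k) x) (f k) = inner ((r *\<^sub>R wshift a) x) (f k)"
    using assms by (cases k) (auto simp: inner_wshift_0 inner_wshift_Suc blinfun.scaleR_left)
qed

lemma wshift_basis:
  assumes "bounded (range a)"
  shows "wshift a (f k) = a k *\<^sub>R f (Suc k)"
proof (rule eq_by_coordinates)
  show "inner (wshift a (f k)) (f j) = inner (a k *\<^sub>R f (Suc k)) (f j)" for j
    using assms by (cases j) (auto simp: inner_wshift_0 inner_wshift_Suc inner_f)
qed

end

subsection \<open>Spectra of weighted shifts\<close>

lemma complex_scale_add: "complex_scale z (u + v) = complex_scale z u + complex_scale z v"
  by (cases u; cases v) (simp add: complex_scale_def algebra_simps)

lemma complex_scale_diff: "complex_scale z (u - v) = complex_scale z u - complex_scale z v"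
  by (cases u; cases v) (simp add: complex_scale_def algebra_simps)

lemma complex_scale_scaleR: "complex_scale z (r *\<^sub>R u) = r *\<^sub>R complex_scale z u"
  by (cases u) (simp add: complex_scale_def algebra_simps)

lemma complex_scale_mult: "complex_scale z (complex_scale w u) = complex_scale (z * w) u"
  by (cases u) (simp add: complex_scale_def algebra_simps)

lemma complex_scale_1: "complex_scale 1 u = u"
  by (cases u) (simp add: complex_scale_def)

lemma norm_complex_scale:
  fixes u :: "'a::real_inner \<times> 'a"
  shows "norm (complex_scale z u) = cmod z * norm u"
proof (cases u)
  case (Pair x y)
  have "(norm (Re z *\<^sub>R x - Im z *\<^sub>R y))\<^sup>2 + (norm (Re z *\<^sub>R y + Im z *\<^sub>R x))\<^sup>2
      = ((Re z)\<^sup>2 + (Im z)\<^sup>2) * ((norm x)\<^sup>2 + (norm y)\<^sup>2)"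
    unfolding power2_norm_eq_inner
    by (simp add: inner_diff_left inner_diff_right inner_add_left inner_add_right inner_commute
        power2_eq_square algebra_simps)
  then show ?thesis
    by (simp add: Pair complex_scale_def norm_Pair cmod_def real_sqrt_mult[symmetric])
qed

lemma complexification_add:
  "complexification A (u + v) = complexification A u + complexification A v"
  by (cases u; cases v) (simp add: complexification_def blinfun.add_right)

lemma complexification_diff:
  "complexification A (u - v) = complexification A u - complexification A v"
  by (cases u; cases v) (simp add: complexification_def blinfun.diff_right)

lemma complexification_scaleR:
  "complexification A (r *\<^sub>R u) = r *\<^sub>R complexification A u"
  by (cases u) (simp add: complexification_def blinfun.scaleR_right)

lemma norm_complexification_le: "norm (complexification A u) \<le> norm A * norm u"
proof (cases u)
  case (Pair x y)
  have "(norm (A x))\<^sup>2 + (norm (A y))\<^sup>2 \<le> (norm A * norm x)\<^sup>2 + (norm A * norm y)\<^sup>2"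
    by (intro add_mono power_mono norm_blinfun) auto
  also have "\<dots> = (norm A)\<^sup>2 * ((norm x)\<^sup>2 + (norm y)\<^sup>2)"
    by (simp add: power_mult_distrib algebra_simps)
  finally have "sqrt ((norm (A x))\<^sup>2 + (norm (A y))\<^sup>2) \<le> sqrt ((norm A)\<^sup>2 * ((norm x)\<^sup>2 + (norm y)\<^sup>2))"
    by (rule real_sqrt_le_mono)
  then show ?thesis
    by (simp add: Pair complexification_def norm_Pair real_sqrt_mult)
qed

text \<open>Ensures that the supremum in \<open>spectral_radius\<close> is over a set bounded above.
  For \<open>norm A < cmod z\<close> the map \<open>D\<close> is bounded below, hence injective with
  bounded inverse; surjectivity comes from Banach's fixed point theorem.\<close>

lemma cmod_spectrum_le:
  fixes A :: "'a::{real_inner, complete_space} \<Rightarrow>\<^sub>L 'a"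
  assumes "z \<in> spectrum A"
  shows "cmod z \<le> norm A"
proof (rule ccontr)
  assume "\<not> cmod z \<le> norm A"
  then have z: "norm A < cmod z"
    by simp
  then have z0: "cmod z > 0" "z \<noteq> 0"
    using norm_ge_zero[of A] by (linarith, auto)
  define D where "D = (\<lambda>u. complexification A u - complex_scale z u)"
  have D_add: "D (u + v) = D u + D v" and D_diff: "D (u - v) = D u - D v"
    and D_scaleR: "D (r *\<^sub>R u) = r *\<^sub>R D u" for u v r
    by (simp_all add: D_def complexification_add complex_scale_add complexification_diff
        complex_scale_diff complexification_scaleR complex_scale_scaleR algebra_simps)
  have bound: "(cmod z - norm A) * norm u \<le> norm (D u)" for u
    using norm_complexification_le[of A u] norm_triangle_ineq2[of "complex_scale z u" "complexification A u"]
    by (simp add: D_def norm_complex_scale norm_minus_commute algebra_simps)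
  have surj: "\<exists>u. D u = v" for v
  proof -
    \<comment> \<open>A fixed point of \<open>h\<close> solves \<open>D u = v\<close>, and
      \<open>h\<close> contracts by the factor \<open>norm A / cmod z\<close>.\<close>
    define h where "h = (\<lambda>u. complex_scale (1 / z) (complexification A u - v))"
    have "dist (h u) (h w) \<le> (norm A / cmod z) * dist u w" for u w
    proof -
      have "dist (h u) (h w) = cmod (1 / z) * norm (complexification A (u - w))"
        unfolding h_def dist_norm complex_scale_diff[symmetric] complexification_diff
        by (simp add: norm_complex_scale)
      also have "\<dots> \<le> cmod (1 / z) * (norm A * norm (u - w))"
        by (intro mult_left_mono norm_complexification_le) auto
      finally show ?thesis
        by (simp add: norm_divide dist_norm)
    qed
    moreover have "0 \<le> norm A / cmod z" "norm A / cmod z < 1"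
      using z z0 by auto
    ultimately have "\<exists>!u. h u = u"
      by (intro banach_fix_type) auto
    then obtain u where "h u = u"
      by blast
    then have "complex_scale z u = complex_scale z (h u)"
      by simp
    also have "\<dots> = complexification A u - v"
      using z0 by (simp add: h_def complex_scale_mult complex_scale_1)
    finally have "D u = v"
      by (simp add: D_def)
    then show ?thesis ..
  qed
  have inj: "u = w" if "D u = D w" for u w
    using bound[of "u - w"] that z by (simp add: D_diff mult_le_0_iff)
  define R where "R = (\<lambda>v. SOME u. D u = v)"
  have DR: "D (R v) = v" for v
    unfolding R_def using surj[of v] by (rule someI_ex)
  have "bounded_linear R"
  proof (rule bounded_linear_intro)
    show "R (u + v) = R u + R v" for u v
      by (rule inj) (simp add: DR D_add)
    show "R (r *\<^sub>R v) = r *\<^sub>R R v" for r v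
      by (rule inj) (simp add: DR D_scaleR)
    show "norm (R v) \<le> norm v * (1 / (cmod z - norm A))" for v
      using bound[of "R v"] z by (simp add: DR field_simps)
  qed
  moreover have "R (D u) = u" for u
    by (rule inj) (simp add: DR)
  ultimately have "z \<notin> spectrum A"
    using DR unfolding spectrum_def D_def by blast
  with assms show False
    by simp
qed

lemma spectral_radius_ge:
  fixes A :: "'a::{real_inner, complete_space} \<Rightarrow>\<^sub>L 'a"
  assumes "z \<in> spectrum A"
  shows "cmod z \<le> spectral_radius A"
  unfolding spectral_radius_def
  using assms cmod_spectrum_le by (intro cSUP_upper bdd_aboveI2)

text \<open>A resolvent would solve the equation with right-hand side \<open>(y, 0)\<close>, whose
  first component is the excluded real equation.\<close>

lemma of_real_in_spectrum:
  fixes A :: "'a::real_normed_vector \<Rightarrow>\<^sub>L 'a"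
  assumes "\<And>x. A x - r *\<^sub>R x \<noteq> y"
  shows "complex_of_real r \<in> spectrum A"
proof -
  have "complexification A u - complex_scale (complex_of_real r) u \<noteq> (y, 0)" for u
    using assms[of "fst u"] by (cases u) (simp add: complexification_def complex_scale_def)
  then show ?thesis
    unfolding spectrum_def by blast
qed

context orthonormal_basis
begin

text \<open>Solving \<open>wshift a x - r *\<^sub>R x = f 0\<close> coordinatewise forces coordinate
  \<open>k\<close> to be \<open>- (\<Prod>i<k. a i) / r ^ Suc k\<close>. For the infinitely many
  \<open>k\<close> in \<open>large\<close> its modulus is at least \<open>1 / r\<close>, so the
  coordinates cannot tend to 0 as square-summability demands.\<close>

lemma in_spectrum_wshift:
  assumes a: "bounded (range a)" and r: "r > 0"
    and large: "\<exists>\<^sub>\<infinity>k. r ^ k \<le> \<bar>\<Prod>i<k. a i\<bar>"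
  shows "complex_of_real r \<in> spectrum (wshift a)"
proof (rule of_real_in_spectrum)
  show "wshift a x - r *\<^sub>R x \<noteq> f 0" for x
  proof
    assume x: "wshift a x - r *\<^sub>R x = f 0"
    have coord: "inner (wshift a x) (f k) - r * inner x (f k) = inner (f 0) (f k)" for k
      unfolding x[symmetric] by (simp add: inner_diff_left)
    have eq: "r ^ Suc k * inner x (f k) = - (\<Prod>i<k. a i)" for k
    proof (induction k)
      case 0
      show ?case
        using coord[of 0] by (simp add: inner_f inner_wshift_0[OF a])
    next
      case (Suc k)
      have "r ^ Suc (Suc k) * inner x (f (Suc k)) = r ^ Suc k * (r * inner x (f (Suc k)))"
        by simp
      also have "r * inner x (f (Suc k)) = a k * inner x (f k)"
        using coord[of "Suc k"] by (simp add: inner_f inner_wshift_Suc[OF a])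
      also have "r ^ Suc k * (a k * inner x (f k)) = (r ^ Suc k * inner x (f k)) * a k"
        by simp
      finally show ?case
        unfolding Suc by simp
    qed
    have "(\<lambda>k. \<bar>inner x (f k)\<bar>) \<longlonglongrightarrow> 0"
      using summable_LIMSEQ_zero[OF sums_summable[OF parseval[of x]]]
      by (simp add: tendsto_rabs_zero_iff)
    then have "\<forall>\<^sub>F k in sequentially. \<bar>inner x (f k)\<bar> < 1 / r"
      using r by (intro order_tendstoD(2)) auto
    then obtain N where N: "\<And>k. k \<ge> N \<Longrightarrow> \<bar>inner x (f k)\<bar> < 1 / r"
      unfolding eventually_sequentially by blast
    obtain k where k: "k \<ge> N" "r ^ k \<le> \<bar>\<Prod>i<k. a i\<bar>"
      using large unfolding INFM_nat_le by blast
    from N[OF k(1)] have "r ^ Suc k * \<bar>inner x (f k)\<bar> < r ^ k"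
      using r by (simp add: field_simps)
    moreover have "r ^ Suc k * \<bar>inner x (f k)\<bar> = \<bar>\<Prod>i<k. a i\<bar>"
      using arg_cong[OF eq[of k], of abs] r by (simp add: abs_mult)
    ultimately show False
      using k(2) by linarith
  qed
qed

end

subsection \<open>Dyadic exponents\<close>

text \<open>The integers of exponent \<open>k\<close> are those congruent to \<open>2 ^ k\<close>
  modulo \<open>2 ^ Suc k\<close>; \<open>?n\<close> is the largest of them not exceeding
  \<open>a + 2 ^ Suc k\<close>. As the basis is indexed from 0, the witness is
  \<open>?n - 1\<close>.\<close>

lemma dyadic_exponent_window:
  "\<exists>j\<ge>a. j < a + 2 ^ Suc k \<and> dyadic_exponent (Suc j) = k"
proof -
  let ?l = "(a + 2 ^ k) div 2 ^ Suc k"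
  let ?n = "2 ^ k * (2 * ?l + 1)"
  have n: "?n = 2 ^ Suc k * ?l + 2 ^ k"
    by (simp add: algebra_simps)
  define q where "q = 2 ^ Suc k * ?l"
  define p where "p = (2::nat) ^ k"
  have "q + (a + p) mod 2 ^ Suc k = a + p"
    unfolding q_def p_def by (simp only: mult_div_mod_eq)
  moreover have "(a + p) mod 2 ^ Suc k < 2 * p"
    unfolding p_def power_Suc[symmetric] by (rule mod_less_divisor) simp
  ultimately have "a < q + p" "q + p \<le> a + 2 * p"
    by linarith+
  then have "a < ?n" "?n \<le> a + 2 ^ Suc k"
    unfolding n q_def p_def by simp_all
  moreover have "dyadic_exponent ?n = k"
    by (rule dyadic_exponent_eqI[OF refl])
  ultimately show ?thesis
    by (intro exI[of _ "?n - 1"]) auto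
qed

lemma dyadic_exponent_power2: "dyadic_exponent (2 ^ j) = j"
  by (rule dyadic_exponent_eqI[of _ _ 0]) simp

text \<open>An \<open>i\<close> below \<open>2 ^ j\<close> has exponent \<open>k < j\<close>, so
  \<open>2 ^ j\<close> is an even multiple of \<open>2 ^ k\<close> and the cofactor stays odd. This
  self-similarity drives the product formula.\<close>

lemma dyadic_exponent_power2_add:
  assumes "0 < i" "i < 2 ^ j"
  shows "dyadic_exponent (2 ^ j + i) = dyadic_exponent i"
proof -
  define k where "k = multiplicity 2 i"
  obtain m where m: "i = 2 ^ k * m" "\<not> 2 dvd m"
    using multiplicity_decompose'[of i 2] assms unfolding k_def by auto
  then obtain l where l: "i = 2 ^ k * (2 * l + 1)"
    by (metis oddE)
  then have "(2::nat) ^ k < 2 ^ j"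
    using assms(2) by (simp add: le_less_trans[rotated])
  then have "k < j"
    by simp
  then have "2 ^ j = (2::nat) ^ k * (2 * 2 ^ (j - Suc k))"
    by (simp flip: power_Suc power_add)
  then have "2 ^ j + i = 2 ^ k * (2 * (2 ^ (j - Suc k) + l) + 1)"
    by (simp add: l algebra_simps)
  then show ?thesis
    using dyadic_exponent_eqI[OF l] by (metis dyadic_exponent_eqI)
qed

lemma prod_lessThan_add:
  fixes g :: "nat \<Rightarrow> 'b::comm_monoid_mult"
  shows "prod g {..<m + n} = prod g {..<m} * (\<Prod>i<n. g (m + i))"
  by (induction n) (simp_all add: mult.assoc)

text \<open>The first \<open>2 ^ Suc j - 1\<close> weights are two copies of the first
  \<open>2 ^ j - 1\<close>, separated by the weight \<open>M / K ^ j\<close> at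
  \<open>2 ^ j\<close>. Relative to \<open>M / K\<close> per factor, the surplus
  \<open>K ^ j\<close> is squared and multiplied by \<open>K / K ^ j\<close>.\<close>

lemma prod_dyadic_weights:
  fixes M K :: real
  assumes "K \<noteq> 0"
  shows "(\<Prod>i<2 ^ j - 1. M / K ^ dyadic_exponent (Suc i)) = (M / K) ^ (2 ^ j - 1) * K ^ j"
proof (induction j)
  case 0
  show ?case
    by simp
next
  case (Suc j)
  let ?g = "\<lambda>i. M / K ^ dyadic_exponent (Suc i)"
  let ?n = "2 ^ j - 1 :: nat"
  have n: "2 ^ Suc j - 1 = Suc ?n + ?n" "Suc ?n = 2 ^ j"
    using one_le_power[of "2::nat" j] by auto
  have "(\<Prod>i<?n. ?g (Suc ?n + i)) = (\<Prod>i<?n. ?g i)"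
  proof (rule prod.cong[OF refl])
    fix i
    assume "i \<in> {..<?n}"
    then have "dyadic_exponent (2 ^ j + Suc i) = dyadic_exponent (Suc i)"
      by (intro dyadic_exponent_power2_add) auto
    then show "?g (Suc ?n + i) = ?g i"
      unfolding n(2) by simp
  qed
  then have "prod ?g {..<2 ^ Suc j - 1} = prod ?g {..<?n} * ?g ?n * prod ?g {..<?n}"
    unfolding n(1) prod_lessThan_add prod.lessThan_Suc by simp
  moreover have "?g ?n = M / K ^ j"
    unfolding n(2) dyadic_exponent_power2 ..
  moreover have "(M / K) ^ n * B * (M / B) * ((M / K) ^ n * B) = (M / K) ^ (Suc n + n) * (K * B)" if "B \<noteq> 0" for n B
    using assms that by (simp add: power_add)
  from this[of "K ^ j" ?n] have "(M / K) ^ ?n * K ^ j * (M / K ^ j) * ((M / K) ^ ?n * K ^ j) = (M / K) ^ (Suc ?n + ?n) * K ^ Suc j"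
    using assms by simp
  ultimately show ?case
    by (simp only: n(1) Suc)
qed

subsection \<open>Perturbations depending on the logarithm of the norm\<close>

lemma filterlim_minus_ln_norm: "filterlim (\<lambda>x::'a::real_normed_vector. - ln (norm x)) at_top (at 0)"
proof -
  have "filterlim (\<lambda>x::'a. norm x) (at_right 0) (at 0)"
    by (auto simp: filterlim_at eventually_at_filter intro!: tendsto_eq_intros)
  then have "filterlim (\<lambda>x::'a. ln (norm x)) at_bot (at 0)"
    by (rule filterlim_compose[OF ln_at_0])
  then show ?thesis
    by (simp add: filterlim_uminus_at_top)
qed

lemma norm_blinfun_apply_div_le: "norm (blinfun_apply A x) / norm x \<le> norm A"
  by (cases "x = 0") (simp_all add: pos_divide_le_eq norm_blinfun)

lemma tendsto_log_radial:
  fixes B :: "real \<Rightarrow> 'a::real_normed_vector \<Rightarrow>\<^sub>L 'b::real_normed_vector"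
  assumes "(B \<longlongrightarrow> 0) at_top"
  shows "((\<lambda>x. norm (B (- ln (norm x)) x) / norm x) \<longlongrightarrow> 0) (at 0)"
proof (rule tendsto_sandwich[OF _ _ tendsto_const])
  have "((\<lambda>x::'a. B (- ln (norm x))) \<longlongrightarrow> 0) (at 0)"
    using assms filterlim_minus_ln_norm by (rule filterlim_compose)
  then show "((\<lambda>x::'a. norm (B (- ln (norm x)))) \<longlongrightarrow> 0) (at 0)"
    by (rule tendsto_norm_zero)
qed (auto intro!: always_eventually norm_blinfun_apply_div_le)

text \<open>Differentiating \<open>- ln (norm x)\<close> costs a factor of order
  \<open>1 / norm x\<close>, which the argument \<open>x\<close> of \<open>B'\<close> compensates.
  The extra term \<open>E\<close> thus has operator norm at most that of
  \<open>B' (- ln (norm x))\<close>, and the decay of \<open>B\<close> and \<open>B'\<close> makes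
  the derivative extend continuously by \<open>W\<close> at 0.\<close>

lemma C1_frechet_log_radial:
  fixes B :: "real \<Rightarrow> 'a::real_inner \<Rightarrow>\<^sub>L 'b::real_normed_vector"
    and W :: "'a \<Rightarrow>\<^sub>L 'b"
  assumes dB: "\<And>s. (B has_vector_derivative B' s) (at s)"
    and contB': "continuous_on UNIV B'"
    and B: "(B \<longlongrightarrow> 0) at_top" and B': "(B' \<longlongrightarrow> 0) at_top"
  shows "C1_frechet (\<lambda>x. W x + B (- ln (norm x)) x)"
proof -
  let ?s = "\<lambda>x::'a. - ln (norm x)"
  \<comment> \<open>\<open>E x\<close> is the rank-one operator sending \<open>h\<close> to
    \<open>inner h x / (norm x)\<^sup>2\<close> times \<open>B' (?s x) x\<close>; the chain rule
    contributes its negative.\<close>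
  define E where "E = (\<lambda>x. (1 / (norm x)\<^sup>2) *\<^sub>R (blinfun_scaleR_left (B' (?s x) x) o\<^sub>L blinfun_inner_left x))"
  define D where "D = (\<lambda>x. if x = 0 then W else W + B (?s x) - E x)"
  have norm_E: "norm (E x) \<le> norm (B' (?s x))" for x
  proof (rule norm_blinfun_bound)
    show "norm (E x h) \<le> norm (B' (?s x)) * norm h" for h
    proof (cases "x = 0")
      case False
      have "norm (E x h) = \<bar>inner h x\<bar> * norm (B' (?s x) x) / (norm x)\<^sup>2"
        by (simp add: E_def blinfun.scaleR_left)
      also have "\<dots> \<le> (norm h * norm x) * (norm (B' (?s x)) * norm x) / (norm x)\<^sup>2"
        by (intro divide_right_mono mult_mono Cauchy_Schwarz_ineq2 norm_blinfun) auto
      also have "\<dots> = norm (B' (?s x)) * norm h"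
        using False by (simp add: power2_eq_square)
      finally show ?thesis .
    qed (simp add: E_def)
  qed simp
  have B0: "((\<lambda>x. B (?s x)) \<longlongrightarrow> 0) (at 0)" and B'0: "((\<lambda>x. B' (?s x)) \<longlongrightarrow> 0) (at 0)"
    by (rule filterlim_compose[OF B filterlim_minus_ln_norm]
        filterlim_compose[OF B' filterlim_minus_ln_norm])+
  have contB: "continuous_on UNIV B"
    using dB has_vector_derivative_continuous continuous_at_imp_continuous_on by blast
  have der: "((\<lambda>x. W x + B (?s x) x) has_derivative D x) (at x)" for x
  proof (cases "x = 0")
    case True
    have "((\<lambda>h. norm (B (?s h) h) / norm h) \<longlongrightarrow> 0) (at 0)"
      by (rule tendsto_log_radial[OF B])
    then have "((\<lambda>x. B (?s x) x) has_derivative (\<lambda>h. 0)) (at 0)"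
      by (simp add: has_derivative_at)
    then have "((\<lambda>x. W x + B (?s x) x) has_derivative (\<lambda>h. W h + 0)) (at 0)"
      by (intro has_derivative_add bounded_linear_imp_has_derivative blinfun.bounded_linear_right)
    then show ?thesis
      by (simp add: True D_def)
  next
    case False
    have "(norm has_derivative (\<lambda>h. inner h (sgn x))) (at x)"
      using False by (rule has_derivative_norm)
    then have s: "(?s has_derivative (\<lambda>h. - (inner h (sgn x) / norm x))) (at x)"
      using False by (auto intro!: derivative_eq_intros simp: field_simps)
    have "((\<lambda>x. B (?s x)) has_derivative (\<lambda>h. - (inner h (sgn x) / norm x) *\<^sub>R B' (?s x))) (at x)"
      using has_derivative_compose[OF s dB[unfolded has_vector_derivative_def]] .
    then have "((\<lambda>x. B (?s x) x) has_derivative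
        (\<lambda>h. B (?s x) h + (- (inner h (sgn x) / norm x) *\<^sub>R B' (?s x)) x)) (at x)"
      by (rule blinfun.FDERIV) (rule has_derivative_ident)
    then have "((\<lambda>x. W x + B (?s x) x) has_derivative
        (\<lambda>h. W h + (B (?s x) h + (- (inner h (sgn x) / norm x) *\<^sub>R B' (?s x)) x))) (at x)"
      by (intro has_derivative_add bounded_linear_imp_has_derivative blinfun.bounded_linear_right)
    moreover have "(\<lambda>h. W h + (B (?s x) h + (- (inner h (sgn x) / norm x) *\<^sub>R B' (?s x)) x)) = D x"
      using False
      by (auto simp: D_def E_def fun_eq_iff blinfun.add_left blinfun.diff_left blinfun.scaleR_left
          blinfun.minus_left sgn_div_norm power2_eq_square divide_inverse)
    ultimately show ?thesis
      by simp
  qed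
  have "isCont D x" for x
  proof (cases "x = 0")
    case True
    have E0: "(E \<longlongrightarrow> 0) (at 0)"
      by (rule Lim_null_comparison[OF _ tendsto_norm_zero[OF B'0]])
        (auto intro!: always_eventually norm_E)
    have "((\<lambda>x. W + B (?s x) - E x) \<longlongrightarrow> W + 0 - 0) (at 0)"
      by (intro tendsto_intros B0 E0)
    moreover have "\<forall>\<^sub>F x in at 0. W + B (?s x) - E x = D x"
      by (auto simp: D_def eventually_at_filter)
    ultimately have "(D \<longlongrightarrow> W) (at 0)"
      using Lim_transform_eventually by force
    then show ?thesis
      by (simp add: True isCont_def D_def)
  next
    case False
    have s: "isCont ?s x"
      using False by (intro continuous_intros) auto
    have BB': "isCont (\<lambda>x. B (?s x)) x" "isCont (\<lambda>x. B' (?s x)) x"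
      using contB contB' s by (auto simp: continuous_on_eq_continuous_at intro: isCont_o2)
    have "isCont (\<lambda>x. W + B (?s x) - E x) x"
      unfolding E_def using False BB'
      by (intro continuous_intros bounded_linear.continuous[OF bounded_linear_blinfun_scaleR_left]
          bounded_bilinear.continuous[OF bounded_bilinear_blinfun_compose]
          bounded_linear.continuous[OF bounded_linear_blinfun_inner_left]) auto
    moreover have "\<forall>\<^sub>F y in nhds x. W + B (?s y) - E y = D y"
      using t1_space_nhds[OF False] by eventually_elim (simp add: D_def)
    ultimately show ?thesis
      by (subst (asm) isCont_cong)
  qed
  then have "continuous_on UNIV D"
    by (simp add: continuous_at_imp_continuous_on)
  with der show ?thesis
    unfolding C1_frechet_def by blast
qed

subsection \<open>Smooth families of shifts and stability\<close>

context orthonormal_basis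
begin

text \<open>The operator norm of a shift is controlled by the supremum of its weights, so
  differentiation in operator norm requires remainders uniform in \<open>k\<close>. The mean value
  estimate for each \<open>b k\<close> derives them from equicontinuity of the
  \<open>b' k\<close>.\<close>

lemma wshift_C1:
  fixes b b' :: "nat \<Rightarrow> real \<Rightarrow> real"
  assumes der: "\<And>k s. (b k has_real_derivative b' k s) (at s)"
    and bdd: "\<And>s. bounded (range (\<lambda>k. b k s))" "\<And>s. bounded (range (\<lambda>k. b' k s))"
    and equicont: "\<And>s d. d > 0 \<Longrightarrow> \<forall>\<^sub>F t in nhds s. \<forall>k. \<bar>b' k t - b' k s\<bar> \<le> d"
  shows "((\<lambda>s. wshift (\<lambda>k. b k s)) has_vector_derivative wshift (\<lambda>k. b' k s)) (at s)"
    and "continuous_on UNIV (\<lambda>s. wshift (\<lambda>k. b' k s))"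
proof -
  have equi: "\<exists>r>0. \<forall>t. dist t s < r \<longrightarrow> (\<forall>k. \<bar>b' k t - b' k s\<bar> \<le> d)" if "d > 0" for d s
    using equicont[OF that, of s] unfolding eventually_nhds_metric .
  show "((\<lambda>s. wshift (\<lambda>k. b k s)) has_vector_derivative wshift (\<lambda>k. b' k s)) (at s)"
    unfolding has_vector_derivative_def has_derivative_at_alt
  proof (intro conjI allI impI bounded_linear_scaleR_left)
    fix d :: real
    assume "d > 0"
    then obtain r where r: "r > 0" "\<And>t k. dist t s < r \<Longrightarrow> \<bar>b' k t - b' k s\<bar> \<le> d"
      using equi[of d s] by blast
    have "norm (wshift (\<lambda>k. b k t) - wshift (\<lambda>k. b k s) - (t - s) *\<^sub>R wshift (\<lambda>k. b' k s))
        \<le> d * norm (t - s)" if t: "norm (t - s) < r" for t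
    proof -
      have eq: "wshift (\<lambda>k. b k t) - wshift (\<lambda>k. b k s) - (t - s) *\<^sub>R wshift (\<lambda>k. b' k s)
          = wshift (\<lambda>k. b k t - b k s - (t - s) * b' k s)"
        using bounded_minus_comp[OF bdd(1)[of t] bdd(1)[of s]]
          bounded_scaleR_comp[OF bdd(2)[of s], of "t - s"]
        by (simp add: wshift_diff wshift_scaleR bdd)
      have "\<bar>b k t - b k s - (t - s) * b' k s\<bar> \<le> d * norm (t - s)" for k
      proof -
        have "norm (b k t - b k s - (t - s) *\<^sub>R b' k s) \<le> norm (t - s) * d"
        proof (rule vector_differentiable_bound_linearization[where S = "ball s r" and f' = "b' k"])
          show "(b k has_vector_derivative b' k u) (at u within ball s r)" for u
            using der[of k u]
            by (simp add: has_real_derivative_iff_has_vector_derivative has_vector_derivative_at_within)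
          show "closed_segment s t \<subseteq> ball s r"
            using r(1) t by (intro closed_segment_subset) (auto simp: dist_norm norm_minus_commute)
          show "norm (b' k u - b' k s) \<le> d" if "u \<in> ball s r" for u
            using r(2)[of u k] that by (simp add: dist_commute)
        qed (use r in auto)
        then show ?thesis
          by (simp add: mult.commute)
      qed
      then show ?thesis
        unfolding eq by (rule norm_wshift_le)
    qed
    then show "\<exists>r>0. \<forall>t. norm (t - s) < r \<longrightarrow>
        norm (wshift (\<lambda>k. b k t) - wshift (\<lambda>k. b k s) - (t - s) *\<^sub>R wshift (\<lambda>k. b' k s))
        \<le> d * norm (t - s)"
      using r(1) by blast
  qed
  show "continuous_on UNIV (\<lambda>s. wshift (\<lambda>k. b' k s))"
    unfolding continuous_on_iff
  proof (intro ballI allI impI)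
    fix s d :: real
    assume "d > 0"
    then obtain r where r: "r > 0" "\<And>t k. dist t s < r \<Longrightarrow> \<bar>b' k t - b' k s\<bar> \<le> d / 2"
      using equi[of "d / 2" s] by auto
    have "dist (wshift (\<lambda>k. b' k t)) (wshift (\<lambda>k. b' k s)) < d" if "dist t s < r" for t
    proof -
      have "norm (wshift (\<lambda>k. b' k t - b' k s)) \<le> d / 2"
        by (rule norm_wshift_le) (rule r(2)[OF that])
      then show ?thesis
        using \<open>d > 0\<close> by (simp add: dist_norm wshift_diff bdd)
    qed
    then show "\<exists>r>0. \<forall>t\<in>UNIV. dist t s < r \<longrightarrow>
        dist (wshift (\<lambda>k. b' k t)) (wshift (\<lambda>k. b' k s)) < d"
      using r(1) by blast
  qed
qed

text \<open>A coordinate of \<open>(T ^^ p) x\<close> with index at least \<open>p\<close> has been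
  carried across \<open>p\<close> consecutive indices. One of them satisfies \<open>P\<close>, and
  crossing it multiplies by 0 at whichever of the \<open>p\<close> steps this happens. Coordinates
  below \<open>p\<close> vanish because every step puts 0 at index 0.\<close>

lemma funpow_shift_eq_0:
  assumes T0: "\<And>x. inner (T x) (f 0) = 0"
    and TSuc: "\<And>x k. inner (T x) (f (Suc k)) = w k x * inner x (f k)"
    and window: "\<And>a. \<exists>j\<ge>a. j < a + p \<and> P j"
    and zero: "\<And>i k. i < p \<Longrightarrow> P k \<Longrightarrow> w k ((T ^^ i) x) = 0"
  shows "(T ^^ p) x = 0"
proof (rule eq_by_coordinates)
  \<comment> \<open>After \<open>i\<close> steps coordinate \<open>k\<close> is zero if it descends
    from a zero inserted at index 0, or if the \<open>i\<close> indices just below \<open>k\<close>,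
    those crossed so far, include one with \<open>P\<close>.\<close>
  have *: "inner ((T ^^ i) x) (f k) = 0"
    if "i \<le> p" "k < i \<or> (\<exists>j\<ge>k - i. j < k \<and> P j)" for i k
    using that
  proof (induction i arbitrary: k)
    case 0
    then show ?case
      by auto
  next
    case (Suc i)
    show ?case
    proof (cases k)
      case 0
      then show ?thesis
        by (simp add: T0)
    next
      case (Suc l)
      have "P l \<or> l < i \<or> (\<exists>j\<ge>l - i. j < l \<and> P j)"
        using Suc.prems(2) Suc by (auto simp: less_Suc_eq)
      then have "w l ((T ^^ i) x) * inner ((T ^^ i) x) (f l) = 0"
        using zero[of i l] Suc.IH[of l] Suc.prems(1) by auto
      then show ?thesis
        by (simp add: Suc TSuc)
    qed
  qed
  show "inner ((T ^^ p) x) (f k) = inner 0 (f k)" for k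
  proof (cases "k < p")
    case True
    then show ?thesis
      using *[of p k] by simp
  next
    case False
    then have "\<exists>j\<ge>k - p. j < k \<and> P j"
      using window[of "k - p"] by simp
    then show ?thesis
      using *[of p k] by simp
  qed
qed

end

section \<open>Iterates and exponential stability\<close>

lemma norm_funpow_le:
  fixes T :: "'a::real_normed_vector \<Rightarrow> 'a"
  assumes "\<And>x. norm (T x) \<le> M * norm x" "0 \<le> M"
  shows "norm ((T ^^ n) x) \<le> M ^ n * norm x"
proof (induction n)
  case (Suc n)
  have "norm ((T ^^ Suc n) x) \<le> M * norm ((T ^^ n) x)"
    using assms(1) by simp
  also have "\<dots> \<le> M * (M ^ n * norm x)"
    using Suc assms(2) by (rule mult_left_mono)
  finally show ?case
    by (simp add: mult.assoc)
qed simp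

text \<open>
  Passing from level \<open>m\<close> to level \<open>j\<close> takes at most \<open>2 ^ Suc j\<close> steps in total, while \<open>- ln\<close> of the
  norm is then of order \<open>4 ^ j\<close>; this beats any exponential rate.
\<close>

lemma exp_asymp_stable_by_cascade:
  fixes T :: "'a::real_normed_vector \<Rightarrow> 'a" and M Q :: real
  assumes T0: "T 0 = 0"
    and growth: "\<And>x. norm (T x) \<le> M * norm x" and M: "1 \<le> M" and Q: "4 * ln M + 2 \<le> Q"
    and cascade: "\<And>k x. norm x \<le> exp (- Q * 4 ^ k) \<Longrightarrow>
      \<exists>i\<le>2 ^ Suc k. norm ((T ^^ i) x) \<le> exp (- Q * 4 ^ Suc k)"
  shows "exp_asymp_stable_at_0 T"
proof -
  have "\<exists>\<delta>>0. \<forall>x. norm x < \<delta> \<longrightarrow> (\<forall>n. norm ((T ^^ n) x) \<le> \<eta> * exp (- 1 / 8) ^ n)"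
    if "\<eta> > 0" for \<eta> :: real
  proof -
    \<comment> \<open>The starting level depends on \<eta>: from it on, \<open>2 ^ j\<close>
      dominates \<open>- ln \<eta>\<close>, which makes up for the prefactor.\<close>
    obtain m where m: "- ln \<eta> \<le> 2 ^ m"
      using real_arch_pow[of 2 "- ln \<eta>"] by (auto intro: less_imp_le)
    have "norm ((T ^^ n) x) \<le> \<eta> * exp (- 1 / 8) ^ n" if x: "norm x < exp (- Q * 4 ^ m)" for x n
    proof -
      \<comment> \<open>Here \<open>j\<close> is the current level and \<open>t\<close> a time at
        which it was attained. The level is raised only after \<open>2 ^ Suc j\<close> further
        steps, by when \<open>cascade\<close> has supplied the next one; the waiting times add up
        geometrically, which preserves \<open>t \<le> 2 ^ Suc j\<close>.\<close>
      have "\<exists>j\<ge>m. \<exists>t\<le>n. t \<le> 2 ^ Suc j \<and> n - t < 2 ^ Suc j \<and> norm ((T ^^ t) x) \<le> exp (- Q * 4 ^ j)"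
      proof (induction n)
        case 0
        show ?case
          using x by (intro exI[of _ m] conjI exI[of _ 0]) auto
      next
        case (Suc n)
        then obtain j t where jt: "j \<ge> m" "t \<le> n" "t \<le> 2 ^ Suc j" "n - t < 2 ^ Suc j"
          "norm ((T ^^ t) x) \<le> exp (- Q * 4 ^ j)"
          by blast
        show ?case
        proof (cases "Suc n - t < 2 ^ Suc j")
          case True
          then show ?thesis
            using jt by (intro exI[of _ j] conjI exI[of _ t]) auto
        next
          case False
          then have n: "Suc n = t + 2 ^ Suc j"
            using jt by simp
          obtain i where i: "i \<le> 2 ^ Suc j" "norm ((T ^^ i) ((T ^^ t) x)) \<le> exp (- Q * 4 ^ Suc j)"
            using cascade[OF jt(5)] by blast
          then show ?thesis
            using jt n
            by (intro exI[of _ "Suc j"] conjI exI[of _ "i + t"]) (auto simp: funpow_add)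
        qed
      qed
      then obtain j t where jt: "j \<ge> m" "t \<le> n" "t \<le> 2 ^ Suc j" "n - t < 2 ^ Suc j"
        "norm ((T ^^ t) x) \<le> exp (- Q * 4 ^ j)"
        by blast
      define u where "u = (2::real) ^ j"
      have u: "1 \<le> u" "(4::real) ^ j = u * u" "(2::real) ^ Suc j = 2 * u"
        by (simp_all add: u_def flip: power_mult_distrib)
      have "- ln \<eta> \<le> u"
        using order_trans[OF m power_increasing[OF jt(1)]] by (simp add: u_def)
      have "real n \<le> 4 * u"
      proof -
        have "n \<le> 2 ^ Suc j + 2 ^ Suc j"
          using jt by linarith
        then have "real n \<le> real (2 ^ Suc j + 2 ^ Suc j)"
          by (simp only: of_nat_le_iff)
        then show ?thesis
          using u(3) by simp
      qed
      have "norm ((T ^^ n) x) = norm ((T ^^ (n - t)) ((T ^^ t) x))"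
        using jt(2) by (metis funpow_add comp_apply le_add_diff_inverse2)
      also have "\<dots> \<le> M ^ (n - t) * exp (- Q * 4 ^ j)"
        using norm_funpow_le[OF growth, of "n - t" "(T ^^ t) x"] M jt(5)
        by (meson mult_left_mono order_trans zero_le_one zero_le_power)
      also have "\<dots> \<le> M ^ (2 ^ Suc j) * exp (- Q * 4 ^ j)"
        using M jt(4) by (intro mult_right_mono power_increasing) auto
      also have "M ^ (2 ^ Suc j) = exp (2 ^ Suc j * ln M)"
        using M exp_of_nat_mult[of "2 ^ Suc j" "ln M"] by simp
      also have "exp (2 ^ Suc j * ln M) * exp (- Q * 4 ^ j) = exp (2 * u * ln M - Q * (u * u))"
        unfolding u(2,3) by (simp flip: exp_add)
      \<comment> \<open>By the assumption on \<open>Q\<close> the exponent is at most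
        \<open>- 2 * (u * u)\<close>, hence at most \<open>- 2 * u\<close>. This suffices, as
        \<open>- u \<le> ln \<eta>\<close> and \<open>real n / 8 \<le> u / 2\<close>.\<close>
      also have "\<dots> \<le> exp (ln \<eta> - real n / 8)"
      proof -
        have "2 * ln M \<le> 4 * ln M * u"
          using u(1) M mult_left_mono[of 1 u "4 * ln M"] ln_ge_zero[OF M] by linarith
        then have "2 * ln M + 2 * u \<le> (4 * ln M + 2) * u"
          by (simp add: algebra_simps)
        also have "\<dots> \<le> Q * u"
          using Q u(1) by (intro mult_right_mono) auto
        finally have "(2 * ln M + 2 * u) * u \<le> Q * u * u"
          using u(1) by (intro mult_right_mono) auto
        moreover have "u \<le> u * u"
          using u(1) by simp
        ultimately show ?thesis
          using \<open>- ln \<eta> \<le> u\<close> \<open>real n \<le> 4 * u\<close> by (simp add: algebra_simps)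
      qed
      also have "\<dots> = \<eta> * exp (- 1 / 8) ^ n"
        using \<open>\<eta> > 0\<close> exp_of_nat_mult[of n "- 1 / 8 :: real"] exp_add[of "ln \<eta>" "- (real n / 8)"]
        by simp
      finally show ?thesis .
    qed
    then show ?thesis
      by (intro exI[of _ "exp (- Q * 4 ^ m)"]) auto
  qed
  moreover have "exp (- 1 / 8 :: real) < 1"
    by simp
  ultimately show ?thesis
    using T0 unfolding exp_asymp_stable_at_0_def by blast
qed

subsection \<open>The cancelled weights\<close>

text \<open>A quadratic C1 spline rising from 0 to 1 on the unit interval:
  \<open>2 * t\<^sup>2\<close> up to 1/2, then \<open>1 - 2 * (1 - t)\<^sup>2\<close>. Positive
  parts give one formula for all \<open>t\<close>; the derivative is a tent of height 2.\<close>

definition ramp :: "real \<Rightarrow> real" where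
  "ramp t = 2 * (max 0 t)\<^sup>2 - 4 * (max 0 (t - 1/2))\<^sup>2 + 2 * (max 0 (t - 1))\<^sup>2"

definition ramp' :: "real \<Rightarrow> real" where
  "ramp' t = 4 * max 0 t - 8 * max 0 (t - 1/2) + 4 * max 0 (t - 1)"

lemma max_0_sq_deriv: "((\<lambda>t::real. (max 0 t)\<^sup>2) has_real_derivative 2 * max 0 t) (at t)"
proof -
  consider "t < 0" | "t = 0" | "t > 0"
    by linarith
  then show ?thesis
  proof cases
    case 1
    have "((\<lambda>t. 0) has_real_derivative 2 * max 0 t) (at t)"
      using 1 by simp
    then show ?thesis
      by (rule DERIV_cong_ev[THEN iffD1, rotated -1])
        (use eventually_nhds_in_open[of "{..<0}" t] 1 in \<open>auto elim!: eventually_mono\<close>)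
  next
    case 2
    have "((\<lambda>h::real. (max 0 h)\<^sup>2 / h) \<longlongrightarrow> 0) (at 0)"
    proof (rule Lim_null_comparison)
      show "\<forall>\<^sub>F h::real in at 0. norm ((max 0 h)\<^sup>2 / h) \<le> \<bar>h\<bar>"
        by (auto simp: max_def power2_eq_square intro!: always_eventually)
      show "((\<lambda>h::real. \<bar>h\<bar>) \<longlongrightarrow> 0) (at 0)"
        by (auto intro!: tendsto_eq_intros)
    qed
    then show ?thesis
      using 2 by (simp add: DERIV_def)
  next
    case 3
    have "((\<lambda>t. t\<^sup>2) has_real_derivative 2 * max 0 t) (at t)"
      using 3 by (auto intro!: derivative_eq_intros)
    then show ?thesis
      by (rule DERIV_cong_ev[THEN iffD1, rotated -1])
        (use eventually_nhds_in_open[of "{0<..}" t] 3 in \<open>auto elim!: eventually_mono\<close>)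
  qed
qed

lemma ramp_deriv: "(ramp has_real_derivative ramp' t) (at t)"
proof -
  have *: "((\<lambda>t. (max 0 (t - u))\<^sup>2) has_real_derivative 2 * max 0 (t - u)) (at t)" for u :: real
    using DERIV_shift[of "\<lambda>t. (max 0 t)\<^sup>2" "2 * max 0 (t - u)" t "- u"] max_0_sq_deriv[of "t - u"]
    by simp
  show ?thesis
    unfolding ramp_def ramp'_def
    using DERIV_add[OF DERIV_diff[OF DERIV_cmult[OF max_0_sq_deriv, of 2]
        DERIV_cmult[OF *, of 4 "1/2"]] DERIV_cmult[OF *, of 2 1]]
    by (rule DERIV_cong) simp
qed

lemma continuous_ramp': "continuous_on A ramp'"
  unfolding ramp'_def by (intro continuous_intros)

lemma ramp_eq_0: "t \<le> 0 \<Longrightarrow> ramp t = 0"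
  by (simp add: ramp_def)

lemma ramp'_eq_0: "t \<le> 0 \<Longrightarrow> ramp' t = 0"
  by (simp add: ramp'_def)

lemma ramp_eq_1: "1 \<le> t \<Longrightarrow> ramp t = 1"
  by (simp add: ramp_def power2_eq_square algebra_simps)

lemma abs_ramp'_le: "\<bar>ramp' t\<bar> \<le> 2"
  by (auto simp: ramp'_def max_def)

lemma ramp_bounds: "0 \<le> ramp t" "ramp t \<le> 1"
proof -
  consider "t \<le> 0" | "0 \<le> t" "t \<le> 1/2" | "1/2 \<le> t" "t \<le> 1" | "1 \<le> t"
    by linarith
  then have "0 \<le> ramp t \<and> ramp t \<le> 1"
  proof cases
    case 2
    then have "t\<^sup>2 \<le> (1/2)\<^sup>2"
      by (intro power_mono) auto
    with 2 show ?thesis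
      by (simp add: ramp_def power2_eq_square)
  next
    case 3
    then have "ramp t = 1 - 2 * (1 - t)\<^sup>2"
      by (simp add: ramp_def power2_eq_square algebra_simps)
    moreover have "(1 - t)\<^sup>2 \<le> (1/2)\<^sup>2"
      using 3 by (intro power_mono) auto
    ultimately show ?thesis
      by (simp add: power2_eq_square)
  qed (simp_all add: ramp_eq_0 ramp_eq_1)
  then show "0 \<le> ramp t" "ramp t \<le> 1"
    by auto
qed

locale kakutani_exponent =
  fixes c :: real
  assumes c: "c > 0"
begin

text \<open>With this \<open>K\<close>, \<open>level k\<close> is
  \<open>M * (4 ^ k) powr - c\<close>, matching the decay \<open>s powr - c\<close> for
  \<open>s\<close> of order \<open>4 ^ k\<close>. The factor 2 in \<open>M\<close> makes
  \<open>M / K\<close> exceed 1.\<close>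

definition "K = (4::real) powr c"
definition "M = 2 * K"
definition "Q = 4 * ln M + 2"
definition "level k = M / K ^ k" for k :: nat
definition "A k = Q * 4 ^ k - 2 ^ Suc k * ln M" for k :: nat
definition "B k = Q * 4 ^ Suc k" for k :: nat
text \<open>
  \<open>A k\<close> is \<open>- ln (M ^ 2 ^ Suc k * exp (- Q * 4 ^ k))\<close>, the logarithmic size of the largest norm that can
  be reached in \<open>2 ^ Suc k\<close> steps from norm \<open>exp (- Q * 4 ^ k)\<close>. The value of \<open>Q\<close> keeps \<open>A k\<close> of order
  \<open>4 ^ k\<close>, so that \<open>level k\<close> is comparable to \<open>s powr - c\<close> on the whole support of \<open>bump k\<close>.
\<close>

definition "bump k s = ramp (s - A k + 1) * ramp (B k + 1 - s)" for k s
definition "bump' k s = ramp' (s - A k + 1) * ramp (B k + 1 - s) - ramp (s - A k + 1) * ramp' (B k + 1 - s)"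
  for k s
text \<open>A substitute for \<open>s powr - c\<close> that is positive and continuously
  differentiable on the whole line; nonpositive \<open>s\<close> occurs where the norm is at least
  1.\<close>

definition "base s = (1 + s\<^sup>2) powr (- c / 2)" for s :: real
definition "base' s = - c * s * (1 + s\<^sup>2) powr (- c / 2 - 1)" for s :: real
definition "weight k s = base s + bump k s * (level k - base s)" for k s
definition "weight' k s = base' s + bump' k s * (level k - base s) - bump k s * base' s" for k s

section \<open>Bounds, derivatives and decay of the weights\<close>

lemma K_gt_1: "1 < K"
  using c by (simp add: K_def)

lemma M_gt_K: "K < M"
  using K_gt_1 by (simp add: M_def)

lemma M_gt_1: "1 < M"
  using K_gt_1 M_gt_K by simp

lemma Q_gt_2: "2 < Q"
  using M_gt_1 by (simp add: Q_def)

lemma level_pos: "0 < level k"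
  using K_gt_1 M_gt_1 by (simp add: level_def)

lemma level_le_M: "level k \<le> M"
  using K_gt_1 M_gt_1 one_le_power[of K k] by (simp add: level_def divide_le_eq)

lemma level_eq: "level k = M * (4 ^ k) powr - c"
proof -
  have "K ^ k = (4 powr real k) powr c"
    using K_gt_1 by (simp add: K_def powr_powr mult.commute flip: powr_realpow)
  also have "\<dots> = (4 ^ k) powr c"
    by (simp add: powr_realpow)
  finally show ?thesis
    by (simp add: level_def powr_minus divide_inverse)
qed

lemma base_pos: "0 < base s"
proof -
  have "0 < 1 + s\<^sup>2"
    by (simp add: add_pos_nonneg)
  then show ?thesis
    by (simp add: base_def)
qed

lemma base_le_1: "base s \<le> 1"
proof -
  have "(1 + s\<^sup>2) powr (- c / 2) \<le> (1 + s\<^sup>2) powr 0"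
    using c by (intro powr_mono) auto
  moreover have "1 + s\<^sup>2 \<noteq> 0"
    by (smt (verit) zero_le_power2)
  ultimately show ?thesis
    by (simp add: base_def)
qed

lemma bump_bounds: "0 \<le> bump k s" "bump k s \<le> 1"
  by (simp_all add: bump_def ramp_bounds mult_le_one)

lemma abs_bump'_le: "\<bar>bump' k s\<bar> \<le> 4"
proof -
  have "\<bar>ramp' (s - A k + 1) * ramp (B k + 1 - s)\<bar> \<le> 2 * 1"
    "\<bar>ramp (s - A k + 1) * ramp' (B k + 1 - s)\<bar> \<le> 1 * 2"
    unfolding abs_mult by (intro mult_mono; simp add: ramp_bounds abs_ramp'_le)+
  then show ?thesis
    unfolding bump'_def by linarith
qed

lemma bump_eq_0:
  assumes "s \<le> A k - 1 \<or> B k + 1 \<le> s"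
  shows "bump k s = 0" "bump' k s = 0"
  using assms by (auto simp: bump_def bump'_def ramp_eq_0 ramp'_eq_0)

lemma weight_eq_level: "A k \<le> s \<Longrightarrow> s \<le> B k \<Longrightarrow> weight k s = level k"
  by (simp add: weight_def bump_def ramp_eq_1)

lemma base_deriv: "(base has_real_derivative base' s) (at s)"
proof -
  have "0 < 1 + s\<^sup>2"
    by (simp add: add_pos_nonneg)
  then show ?thesis
    unfolding base_def base'_def
    by (auto intro!: derivative_eq_intros simp: powr_diff field_simps)
qed

lemma bump_deriv: "(bump k has_real_derivative bump' k s) (at s)"
proof -
  have 1: "((\<lambda>s. ramp (s - A k + 1)) has_real_derivative ramp' (s - A k + 1) * 1) (at s)"
    by (rule DERIV_chain'[OF _ ramp_deriv]) (auto intro!: derivative_eq_intros)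
  have 2: "((\<lambda>s. ramp (B k + 1 - s)) has_real_derivative ramp' (B k + 1 - s) * (- 1)) (at s)"
    by (rule DERIV_chain'[OF _ ramp_deriv]) (auto intro!: derivative_eq_intros)
  show ?thesis
    unfolding bump_def bump'_def using DERIV_mult[OF 1 2] by (simp add: algebra_simps)
qed

lemma weight_deriv: "(weight k has_real_derivative weight' k s) (at s)"
  unfolding weight_def weight'_def
  by (auto intro!: derivative_eq_intros base_deriv bump_deriv simp: algebra_simps)

lemma continuous_base: "continuous_on S base"
  using base_deriv DERIV_continuous_on has_field_derivative_at_within by blast

lemma continuous_base': "continuous_on S base'"
proof -
  have "1 + s\<^sup>2 \<noteq> 0" for s :: real
    by (smt (verit) zero_le_power2)
  then show ?thesis
    unfolding base'_def by (auto intro!: continuous_intros)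
qed

lemma continuous_weight': "continuous_on S (weight' k)"
proof -
  have "continuous_on S (bump k)"
    using bump_deriv DERIV_continuous_on has_field_derivative_at_within by blast
  moreover have ramp: "continuous_on T ramp" for T
    using ramp_deriv DERIV_continuous_on has_field_derivative_at_within by blast
  have "continuous_on S (bump' k)"
    unfolding bump'_def
    by (intro continuous_intros continuous_on_compose2[OF ramp] continuous_on_compose2[OF continuous_ramp']) auto
  ultimately show ?thesis
    unfolding weight'_def by (intro continuous_intros continuous_base continuous_base')
qed

text \<open>Here the size of \<open>Q\<close> pays off: \<open>2 ^ Suc k * ln M\<close> is at most
  half of the part \<open>4 * ln M * 4 ^ k\<close> of \<open>Q * 4 ^ k\<close>. The other part,
  \<open>2 * 4 ^ k\<close>, exceeds its half by at least 1, which makes room for the left flank of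
  the bump.\<close>

lemma A_ge: "Q * 4 ^ k / 2 + 1 \<le> A k"
proof -
  define u v :: real where "u = 4 ^ k" and "v = 2 ^ k"
  have "v \<le> u" "1 \<le> u"
    by (auto simp: u_def v_def intro: power_mono)
  moreover have "v * ln M \<le> u * ln M"
    using M_gt_1 \<open>v \<le> u\<close> by (intro mult_right_mono) auto
  moreover have "A k = 4 * (u * ln M) + 2 * u - 2 * (v * ln M)"
    by (simp add: A_def Q_def u_def v_def algebra_simps)
  moreover have "Q * 4 ^ k / 2 = 2 * (u * ln M) + u"
    by (simp add: Q_def u_def algebra_simps)
  ultimately show ?thesis
    by linarith
qed

text \<open>The supports of the bumps escape to infinity with \<open>k\<close>, so around a given
  \<open>s\<close> all but finitely many weights are \<open>base\<close>. Boundedness and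
  equicontinuity uniform in \<open>k\<close> rest on this.\<close>

lemma weight_far:
  assumes "s \<le> real k"
  shows "weight k s = base s" "weight' k s = base' s"
proof -
  have "real k \<le> 4 ^ k"
    using less_exp[of k] power_mono[of 2 "4::real" k] by (smt (verit) of_nat_less_two_power)
  also have "\<dots> \<le> Q * 4 ^ k / 2"
    using Q_gt_2 by simp
  also have "\<dots> \<le> A k - 1"
    using A_ge[of k] by simp
  finally have "s \<le> A k - 1"
    using assms by simp
  then show "weight k s = base s" "weight' k s = base' s"
    by (simp_all add: weight_def weight'_def bump_eq_0)
qed

lemma weight_pos: "0 < weight k s"
  and weight_le_M: "weight k s \<le> M"
proof -
  have eq: "weight k s = (1 - bump k s) * base s + bump k s * level k"
    by (simp add: weight_def algebra_simps)
  show "0 < weight k s"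
  proof (cases "bump k s = 1")
    case False
    then show ?thesis
      unfolding eq using bump_bounds[of k s] base_pos[of s] level_pos[of k]
      by (intro add_pos_nonneg) auto
  qed (simp add: eq level_pos)
  have "weight k s \<le> (1 - bump k s) * M + bump k s * M"
    unfolding eq using bump_bounds[of k s] base_le_1[of s] M_gt_1 level_le_M[of k]
    by (intro add_mono mult_left_mono) auto
  then show "weight k s \<le> M"
    by (simp add: algebra_simps)
qed

lemma abs_level_minus_weight_le: "\<bar>level k - weight k s\<bar> \<le> M"
  using weight_pos[of k s] weight_le_M[of k s] level_pos[of k] level_le_M[of k] by linarith

lemma base_asymp:
  assumes "1 \<le> s"
  shows "2 powr (- c / 2) * s powr - c \<le> base s" "base s \<le> s powr - c"
proof -
  have sq: "(s\<^sup>2) powr (- c / 2) = s powr - c"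
    using assms by (simp add: powr_powr flip: powr_numeral)
  have "1 \<le> s\<^sup>2"
    using assms by simp
  then have "(2 * s\<^sup>2) powr (- c / 2) \<le> (1 + s\<^sup>2) powr (- c / 2)"
    using c by (intro powr_mono2') auto
  then show "2 powr (- c / 2) * s powr - c \<le> base s"
    using assms by (simp add: base_def powr_mult sq[simplified])
  have "(1 + s\<^sup>2) powr (- c / 2) \<le> (s\<^sup>2) powr (- c / 2)"
    using c assms by (intro powr_mono2') auto
  then show "base s \<le> s powr - c"
    by (simp add: base_def sq[simplified])
qed

text \<open>The logarithmic derivative of \<open>base\<close> is
  \<open>- c * s / (1 + s\<^sup>2)\<close>, and
  \<open>\<bar>s\<bar> \<le> 1 + s\<^sup>2\<close>.\<close>

lemma abs_base'_le: "\<bar>base' s\<bar> \<le> c * base s"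
proof -
  have pos: "0 < 1 + s\<^sup>2"
    by (simp add: add_pos_nonneg)
  have "\<bar>s\<bar> \<le> 1 + s\<^sup>2"
    using sum_squares_bound[of "\<bar>s\<bar>" 1] by (simp add: power2_eq_square)
  then have "\<bar>s\<bar> / (1 + s\<^sup>2) \<le> 1"
    using pos by simp
  moreover have "\<bar>base' s\<bar> = c * base s * (\<bar>s\<bar> / (1 + s\<^sup>2))"
    using c pos by (simp add: base'_def base_def powr_diff abs_mult)
  ultimately show ?thesis
    using mult_left_mono[of "\<bar>s\<bar> / (1 + s\<^sup>2)" 1 "c * base s"] c base_pos[of s] by simp
qed

text \<open>The first entries of the minimum and maximum serve \<open>base\<close>, from
  \<open>s\<^sup>2 \<le> 1 + s\<^sup>2 \<le> 2 * s\<^sup>2\<close>. The second ones serve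
  \<open>level k\<close>: for \<open>s \<ge> 1\<close> in the support of the bump,
  \<open>4 ^ k\<close> lies between \<open>s / (5 * Q)\<close> and \<open>2 * s / Q\<close>.\<close>

definition "lower = min (2 powr (- c / 2)) (M * (2 / Q) powr - c)"
definition "upper = max 1 (M * (1 / (5 * Q)) powr - c)"

lemma lower_pos: "0 < lower"
  using M_gt_1 Q_gt_2 by (simp add: lower_def)

lemma upper_pos: "0 < upper"
  by (simp add: upper_def)

lemma level_asymp:
  assumes "1 \<le> s" "A k - 1 < s" "s < B k + 1"
  shows "lower * s powr - c \<le> level k" "level k \<le> upper * s powr - c"
proof -
  have Q: "0 < Q"
    using Q_gt_2 by simp
  have "Q * 4 ^ k / 2 \<le> s"
    using A_ge[of k] assms(2) by simp
  then have "4 ^ k \<le> 2 / Q * s"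
    using Q by (simp add: field_simps)
  then have "(2 / Q * s) powr - c \<le> (4 ^ k) powr - c"
    using c by (intro powr_mono2') auto
  then have "(2 / Q) powr - c * s powr - c \<le> (4 ^ k) powr - c"
    using assms(1) Q by (simp only: powr_mult)
  then have "M * ((2 / Q) powr - c * s powr - c) \<le> level k"
    unfolding level_eq using M_gt_1 by (intro mult_left_mono) auto
  moreover have "lower * s powr - c \<le> (M * (2 / Q) powr - c) * s powr - c"
    by (intro mult_right_mono) (auto simp: lower_def)
  ultimately show "lower * s powr - c \<le> level k"
    by (simp only: mult.assoc)
  \<comment> \<open>Absorbs the unit flank: \<open>B k + 1\<close> is at most five times
    \<open>Q * 4 ^ k\<close>.\<close>
  have "1 \<le> Q * 4 ^ k"
    using Q_gt_2 mult_mono[of 1 Q 1 "4 ^ k"] by simp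
  then have "s \<le> 5 * Q * 4 ^ k"
    using assms(3) by (simp add: B_def)
  then have "1 / (5 * Q) * s \<le> 4 ^ k"
    using Q by (simp add: field_simps)
  then have "(4 ^ k) powr - c \<le> (1 / (5 * Q) * s) powr - c"
    using c assms(1) Q by (intro powr_mono2') auto
  then have "(4 ^ k) powr - c \<le> (1 / (5 * Q)) powr - c * s powr - c"
    using assms(1) Q by (simp only: powr_mult)
  then have "level k \<le> M * ((1 / (5 * Q)) powr - c * s powr - c)"
    unfolding level_eq using M_gt_1 by (intro mult_left_mono) auto
  moreover have "(M * (1 / (5 * Q)) powr - c) * s powr - c \<le> upper * s powr - c"
    by (intro mult_right_mono) (auto simp: upper_def)
  ultimately show "level k \<le> upper * s powr - c"
    by (simp only: mult.assoc)
qed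

text \<open>The weight is a convex combination of \<open>base s\<close> and \<open>level k\<close>,
  both comparable to \<open>s powr - c\<close> where the bump lives. In the derivative,
  \<open>base'\<close> enters twice, and the slope of the bump, at most 4, multiplies a difference
  bounded by \<open>upper * s powr - c\<close>.\<close>

lemma weight_asymp:
  assumes "1 \<le> s"
  shows "lower * s powr - c \<le> weight k s" "weight k s \<le> upper * s powr - c"
    and "\<bar>weight' k s\<bar> \<le> (2 * c + 4 * upper) * s powr - c"
proof -
  let ?p = "s powr - c"
  have base: "lower * ?p \<le> base s" "base s \<le> upper * ?p" "base s \<le> ?p"
  proof -
    have "lower * ?p \<le> 2 powr (- c / 2) * ?p" "1 * ?p \<le> upper * ?p"
      by (intro mult_right_mono; simp add: lower_def upper_def)+
    then show "lower * ?p \<le> base s" "base s \<le> upper * ?p" "base s \<le> ?p"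
      using base_asymp[OF assms] by linarith+
  qed
  have base': "\<bar>base' s\<bar> \<le> c * ?p"
    using abs_base'_le[of s] mult_left_mono[OF base(3), of c] c by linarith
  have p: "0 \<le> c * ?p" "0 \<le> upper * ?p"
    using c upper_pos by auto
  consider "s \<le> A k - 1 \<or> B k + 1 \<le> s" | "A k - 1 < s" "s < B k + 1"
    by linarith
  then have "lower * ?p \<le> weight k s \<and> weight k s \<le> upper * ?p \<and>
    \<bar>weight' k s\<bar> \<le> (2 * c + 4 * upper) * ?p"
  proof cases
    case 1
    then show ?thesis
      using base base' p by (simp add: weight_def weight'_def bump_eq_0 algebra_simps)
  next
    case 2
    note level = level_asymp[OF assms 2]
    have eq: "weight k s = (1 - bump k s) * base s + bump k s * level k"
      by (simp add: weight_def algebra_simps)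
    have w: "lower * ?p = (1 - bump k s) * (lower * ?p) + bump k s * (lower * ?p)"
      "upper * ?p = (1 - bump k s) * (upper * ?p) + bump k s * (upper * ?p)"
      by (simp_all add: algebra_simps)
    have lo: "lower * ?p \<le> weight k s"
      unfolding eq by (subst w(1), intro add_mono mult_left_mono base level)
        (use bump_bounds[of k s] in auto)
    have up: "weight k s \<le> upper * ?p"
      unfolding eq by (subst w(2), intro add_mono mult_left_mono base level)
        (use bump_bounds[of k s] in auto)
    have "\<bar>level k - base s\<bar> \<le> upper * ?p"
      using base level level_pos[of k] base_pos[of s] by linarith
    then have 1: "\<bar>bump' k s * (level k - base s)\<bar> \<le> 4 * (upper * ?p)"
      unfolding abs_mult using abs_bump'_le[of k s] by (intro mult_mono) auto
    have 2: "\<bar>bump k s * base' s\<bar> \<le> 1 * (c * ?p)"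
      unfolding abs_mult using bump_bounds[of k s] base' by (intro mult_mono) auto
    have "(2 * c + 4 * upper) * ?p = 2 * (c * ?p) + 4 * (upper * ?p)"
      by (simp add: algebra_simps)
    then have "\<bar>weight' k s\<bar> \<le> (2 * c + 4 * upper) * ?p"
      unfolding weight'_def using 1 2 base' by linarith
    with lo up show ?thesis
      by blast
  qed
  then show "lower * ?p \<le> weight k s" "weight k s \<le> upper * ?p"
    "\<bar>weight' k s\<bar> \<le> (2 * c + 4 * upper) * ?p"
    by blast+
qed

end

subsection \<open>The map\<close>

locale kakutani_map = orthonormal_basis f + kakutani_exponent c
  for f :: "nat \<Rightarrow> 'a::{real_inner, complete_space}" and c :: real
begin

text \<open>The vector \<open>f n\<close> stands for the basis vector of index
  \<open>Suc n\<close>.\<close>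

abbreviation "lev n \<equiv> dyadic_exponent (Suc n)"

definition "W = wshift (\<lambda>n. level (lev n))"
definition "perturb s = wshift (\<lambda>n. - weight (lev n) s)"
definition "perturb' s = wshift (\<lambda>n. - weight' (lev n) s)"
definition "N x = perturb (- ln (norm x)) x"
definition "T x = W x + N x"

lemma bounded_levels: "bounded (range (\<lambda>n. level (lev n)))"
  by (rule bounded_weights[of _ M]) (simp add: level_pos less_imp_le level_le_M)

lemma abs_weight_le: "\<bar>- weight k s\<bar> \<le> M"
  using weight_pos[of k s] weight_le_M[of k s] by simp

lemma bounded_perturb: "bounded (range (\<lambda>n. - weight (lev n) s))"
  by (rule bounded_weights[of _ M]) (rule abs_weight_le)

lemma bounded_perturb': "bounded (range (\<lambda>n. - weight' (lev n) s))"
proof -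
  obtain J :: nat where J: "s \<le> real J"
    using real_arch_simple by blast
  \<comment> \<open>The sum takes care of the finitely many \<open>k < J\<close>, the
    \<open>base'\<close> term of all others.\<close>
  have "\<bar>- weight' k s\<bar> \<le> \<bar>base' s\<bar> + (\<Sum>j<J. \<bar>weight' j s\<bar>)" for k
  proof (cases "k < J")
    case True
    then have "\<bar>weight' k s\<bar> \<le> (\<Sum>j<J. \<bar>weight' j s\<bar>)"
      by (intro member_le_sum) auto
    then show ?thesis
      by simp
  next
    case False
    then have "weight' k s = base' s"
      using J by (intro weight_far) simp
    then show ?thesis
      by (simp add: sum_nonneg)
  qed
  then show ?thesis
    by (rule bounded_weights)
qed

lemma inner_T:
  "inner (T x) (f 0) = 0"
  "inner (T x) (f (Suc k)) = (level (lev k) - weight (lev k) (- ln (norm x))) * inner x (f k)"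
  by (simp_all add: T_def N_def W_def perturb_def inner_add_left
      inner_wshift_0[OF bounded_levels] inner_wshift_Suc[OF bounded_levels]
      inner_wshift_0[OF bounded_perturb] inner_wshift_Suc[OF bounded_perturb] algebra_simps)

lemma norm_T_le: "norm (T x) \<le> M * norm x"
  by (rule norm_shift_le[OF inner_T]) (rule abs_level_minus_weight_le)

text \<open>If all these norms stayed above the target, their negative logarithms would remain in
  \<open>[A k, B k]\<close>, with the lower end due to the growth bound. Then every weight of
  exponent \<open>k\<close> cancels, \<open>funpow_shift_eq_0\<close> annihilates the orbit, and 0
  is not above the target.\<close>

lemma T_cascade:
  assumes x: "norm x \<le> exp (- Q * 4 ^ k)"
  shows "\<exists>i\<le>2 ^ Suc k. norm ((T ^^ i) x) \<le> exp (- Q * 4 ^ Suc k)"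
proof (rule ccontr)
  assume "\<not> ?thesis"
  then have low: "exp (- Q * 4 ^ Suc k) < norm ((T ^^ i) x)" if "i \<le> 2 ^ Suc k" for i
    using that by force
  have "(T ^^ (2 ^ Suc k)) x = 0"
  proof (rule funpow_shift_eq_0[where P = "\<lambda>j. lev j = k"])
    show "level (lev j) - weight (lev j) (- ln (norm ((T ^^ i) x))) = 0"
      if "i < 2 ^ Suc k" "lev j = k" for i j
    proof -
      let ?y = "(T ^^ i) x"
      have pos: "0 < norm ?y"
        using low[of i] that(1) exp_gt_zero[of "- Q * 4 ^ Suc k"] by linarith
      have "norm ?y \<le> M ^ i * norm x"
        using M_gt_1 by (intro norm_funpow_le norm_T_le) simp
      also have "\<dots> \<le> M ^ 2 ^ Suc k * exp (- Q * 4 ^ k)"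
        using M_gt_1 that(1) x by (intro mult_mono power_increasing) auto
      also have "M ^ 2 ^ Suc k = exp (2 ^ Suc k * ln M)"
        using M_gt_1 exp_of_nat_mult[of "2 ^ Suc k" "ln M"] by simp
      also have "\<dots> * exp (- Q * 4 ^ k) = exp (- A k)"
        by (simp add: A_def flip: exp_add)
      finally have "ln (norm ?y) \<le> - A k"
        using pos ln_le_cancel_iff[of "norm ?y" "exp (- A k)"] by simp
      moreover have "- B k < ln (norm ?y)"
        using low[of i] that(1) pos ln_less_cancel_iff[of "exp (- B k)" "norm ?y"]
        by (simp add: B_def)
      ultimately show ?thesis
        using weight_eq_level[of k "- ln (norm ?y)"] that(2) by simp
    qed
  qed (use inner_T dyadic_exponent_window in auto)
  then show False
    using low[of "2 ^ Suc k"] by (simp add: not_less less_imp_le)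
qed

lemma T_stable: "exp_asymp_stable_at_0 T"
proof (rule exp_asymp_stable_by_cascade[where M = M and Q = Q])
  show "T 0 = 0"
    by (simp add: T_def N_def blinfun.zero_right)
qed (use norm_T_le M_gt_1 T_cascade in \<open>auto simp: Q_def\<close>)

lemma perturb_C1:
  "(perturb has_vector_derivative perturb' s) (at s)" "continuous_on UNIV perturb'"
proof -
  have *: "\<forall>\<^sub>F t in nhds s. \<forall>n. \<bar>- weight' (lev n) t - - weight' (lev n) s\<bar> \<le> d"
    if "d > 0" for s d
  proof -
    \<comment> \<open>The margin 1 keeps every \<open>t < s + 1\<close> below \<open>J\<close> as
      well, so for \<open>k \<ge> J\<close> both derivatives are values of
      \<open>base'\<close>.\<close>
    obtain J :: nat where J: "s + 1 \<le> real J"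
      using real_arch_simple by blast
    have near: "\<forall>\<^sub>F t in nhds s. dist (g t) (g s) < d"
      if "\<And>S. continuous_on S g" for g :: "real \<Rightarrow> real"
    proof -
      have "isCont g s"
        using that[of UNIV] by (simp add: continuous_on_eq_continuous_at)
      then have "(g \<longlongrightarrow> g s) (nhds s)"
        by (simp add: isCont_def tendsto_at_iff_tendsto_nhds)
      then show ?thesis
        using \<open>d > 0\<close> by (rule tendstoD)
    qed
    have "\<forall>\<^sub>F t in nhds s. \<forall>k\<in>{..<J}. dist (weight' k t) (weight' k s) < d"
      by (intro eventually_ball_finite ballI near continuous_weight') simp
    moreover have "\<forall>\<^sub>F t in nhds s. dist (base' t) (base' s) < d"
      by (rule near) (rule continuous_base')
    moreover have "\<forall>\<^sub>F t in nhds s. t < s + 1"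
      using eventually_nhds_in_open[of "{..<s + 1}" s] by simp
    ultimately show ?thesis
    proof eventually_elim
      case (elim t)
      have "dist (weight' k t) (weight' k s) < d" for k
      proof (cases "k < J")
        case False
        then have "weight' k t = base' t" "weight' k s = base' s"
          using J elim(3) by (intro weight_far; simp)+
        then show ?thesis
          using elim(2) by simp
      qed (use elim(1) in simp)
      then show ?case
        by (simp add: dist_real_def less_imp_le abs_minus_commute)
    qed
  qed
  have der: "((\<lambda>s. - weight k s) has_real_derivative - weight' k s) (at s)" for k s
    by (intro DERIV_minus weight_deriv)
  show "(perturb has_vector_derivative perturb' s) (at s)" "continuous_on UNIV perturb'"
    unfolding perturb_def perturb'_def
    by (rule wshift_C1[OF der bounded_perturb bounded_perturb' *]; assumption)+
qed

lemma perturb_tendsto_0: "(perturb \<longlongrightarrow> 0) at_top" "(perturb' \<longlongrightarrow> 0) at_top"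
proof -
  have p: "((\<lambda>s. C * s powr - c) \<longlongrightarrow> 0) at_top" for C
    using tendsto_mult_right_zero[OF tendsto_neg_powr[OF _ filterlim_ident, of "- c"]] c by simp
  have "norm (perturb s) \<le> upper * s powr - c" if "1 \<le> s" for s
    unfolding perturb_def using weight_asymp[OF that] weight_pos
    by (intro norm_wshift_le) (simp add: less_imp_le)
  then show "(perturb \<longlongrightarrow> 0) at_top"
    by (intro Lim_null_comparison[OF _ p[of upper]] eventually_mono[OF eventually_ge_at_top[of 1]])
  have "norm (perturb' s) \<le> (2 * c + 4 * upper) * s powr - c" if "1 \<le> s" for s
    unfolding perturb'_def using weight_asymp[OF that]
    by (intro norm_wshift_le) simp
  then show "(perturb' \<longlongrightarrow> 0) at_top"
    by (intro Lim_null_comparison[OF _ p[of "2 * c + 4 * upper"]]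
        eventually_mono[OF eventually_ge_at_top[of 1]])
qed

lemma T_C1: "C1_frechet T"
  unfolding T_def N_def using perturb_C1 perturb_tendsto_0 by (rule C1_frechet_log_radial)

lemma N_small: "((\<lambda>x. norm (N x) / norm x) \<longlongrightarrow> 0) (at 0)"
  unfolding N_def using perturb_tendsto_0(1) by (rule tendsto_log_radial)

text \<open>At lengths \<open>2 ^ j - 1\<close> the product of weights is a power of
  \<open>M / K\<close> with surplus \<open>K ^ j \<ge> 1\<close>, which puts
  \<open>M / K = 2\<close> into the spectrum.\<close>

lemma spectral_radius_W: "1 < spectral_radius W"
proof -
  have "\<exists>\<^sub>\<infinity>k. (M / K) ^ k \<le> \<bar>\<Prod>i<k. level (lev i)\<bar>"
    unfolding INFM_nat_le
  proof
    fix j :: nat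
    have "(M / K) ^ (2 ^ j - 1) * 1 \<le> (M / K) ^ (2 ^ j - 1) * K ^ j"
      using K_gt_1 M_gt_1 by (intro mult_left_mono) auto
    also have "\<dots> = (\<Prod>i<2 ^ j - 1. level (lev i))"
      using prod_dyadic_weights[of K M j] K_gt_1 by (simp add: level_def)
    also have "\<dots> \<le> \<bar>\<Prod>i<2 ^ j - 1. level (lev i)\<bar>"
      by (rule abs_ge_self)
    finally have "(M / K) ^ (2 ^ j - 1) \<le> \<bar>\<Prod>i<2 ^ j - 1. level (lev i)\<bar>"
      by simp
    moreover have "j \<le> 2 ^ j - 1"
      using less_exp[of j] by linarith
    ultimately show "\<exists>n\<ge>j. (M / K) ^ n \<le> \<bar>\<Prod>i<n. level (lev i)\<bar>"
      by blast
  qed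
  then have "complex_of_real (M / K) \<in> spectrum W"
    unfolding W_def using K_gt_1 M_gt_1 by (intro in_spectrum_wshift bounded_levels) auto
  then have "cmod (complex_of_real (M / K)) \<le> spectral_radius W"
    by (rule spectral_radius_ge)
  moreover have "1 < M / K"
    using K_gt_1 by (simp add: M_def)
  ultimately show ?thesis
    by (simp only: norm_of_real)
qed

text \<open>The ratio lies between \<open>lower\<close> and \<open>upper\<close> times
  \<open>s powr - c\<close>; the positive gaps \<open>c\<^sub>2 - c\<close> and
  \<open>c - c\<^sub>1\<close> give powers of \<open>s\<close> that eventually absorb these
  constants.\<close>

lemma N_asymp:
  assumes "c\<^sub>1 < c" "c < c\<^sub>2"
  shows "\<forall>\<^sub>F x in at 0.
    (1 / (- ln (norm x))) powr c\<^sub>2 < norm (N x) / norm x \<and>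
    norm (N x) / norm x < 4 * (1 / (- ln (norm x))) powr c\<^sub>1"
proof -
  have "\<forall>\<^sub>F s in at_top. s powr - (c\<^sub>2 - c) < lower"
    using tendsto_neg_powr[OF _ filterlim_ident, of "- (c\<^sub>2 - c)"] assms(2) lower_pos
    by (intro order_tendstoD(2)) auto
  moreover have "\<forall>\<^sub>F s in at_top. s powr - (c - c\<^sub>1) < 4 / upper"
    using tendsto_neg_powr[OF _ filterlim_ident, of "- (c - c\<^sub>1)"] assms(1) upper_pos
    by (intro order_tendstoD(2)) auto
  moreover have "\<forall>\<^sub>F s in at_top. 1 \<le> (s::real)"
    by (rule eventually_ge_at_top)
  ultimately have "\<forall>\<^sub>F s in at_top. 1 \<le> s \<and> s powr - (c\<^sub>2 - c) < lower \<and> s powr - (c - c\<^sub>1) < 4 / upper"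
    by eventually_elim simp
  then have "\<forall>\<^sub>F x::'a in at 0. 1 \<le> - ln (norm x) \<and> (- ln (norm x)) powr - (c\<^sub>2 - c) < lower \<and>
      (- ln (norm x)) powr - (c - c\<^sub>1) < 4 / upper"
    using filterlim_minus_ln_norm by (rule eventually_compose_filterlim)
  moreover have "\<forall>\<^sub>F x::'a in at 0. x \<noteq> 0"
    by (simp add: eventually_at_filter)
  ultimately show ?thesis
  proof eventually_elim
    case (elim x)
    define s where "s = - ln (norm x)"
    have s: "1 \<le> s" "s powr - (c\<^sub>2 - c) < lower" "s powr - (c - c\<^sub>1) < 4 / upper"
      using elim by (simp_all add: s_def)
    have inv: "(1 / s) powr a = s powr - a" for a
      using s(1) by (simp add: powr_divide powr_minus_divide)
    have "s powr - c\<^sub>2 = s powr - (c\<^sub>2 - c) * s powr - c"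
      by (simp flip: powr_add)
    also have "\<dots> < lower * s powr - c"
      using s by (intro mult_strict_right_mono) auto
    finally have 1: "s powr - c\<^sub>2 < lower * s powr - c" .
    have "upper * s powr - c = upper * s powr - (c - c\<^sub>1) * s powr - c\<^sub>1"
      by (simp add: mult.assoc flip: powr_add)
    also have "\<dots> < 4 * s powr - c\<^sub>1"
      using s upper_pos by (intro mult_strict_right_mono) (auto simp: field_simps)
    finally have 2: "upper * s powr - c < 4 * s powr - c\<^sub>1" .
    have "lower * s powr - c * norm x \<le> norm (N x)"
      unfolding N_def s_def[symmetric] perturb_def
      using weight_asymp(1)[OF s(1)] weight_pos lower_pos
      by (intro norm_wshift_apply_ge bounded_perturb) (auto simp: less_imp_le)
    moreover have "norm (N x) \<le> upper * s powr - c * norm x"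
      unfolding N_def s_def[symmetric] perturb_def
      using weight_asymp(2)[OF s(1)] weight_pos
      by (intro norm_wshift_apply_le) (auto simp: less_imp_le)
    ultimately have "lower * s powr - c \<le> norm (N x) / norm x" "norm (N x) / norm x \<le> upper * s powr - c"
      using elim(2) by (simp_all add: pos_le_divide_eq pos_divide_le_eq)
    then show ?case
      unfolding s_def[symmetric] inv using 1 2 by linarith
  qed
qed

end

theorem theorem1:
  fixes e :: "nat \<Rightarrow> 'a::{real_inner, complete_space}"
    and c\<^sub>1 c\<^sub>2 :: real
  assumes "hilbert_basis e"
    and "0 < c\<^sub>1" and "c\<^sub>1 < c\<^sub>2"
  shows "\<exists>M K :: real. 1 < K \<and> K < M \<and>
    (let \<epsilon> = (\<lambda>m. M / K ^ (m - 1)) in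
      strictly_decreasing_to_zero \<epsilon> \<and>
      (\<exists>W :: 'a \<Rightarrow>\<^sub>L 'a. weighted_shift e (kakutani_weights \<epsilon>) W \<and>
        (\<exists>N :: 'a \<Rightarrow> 'a. N 0 = 0 \<and>
          (let T = (\<lambda>x. blinfun_apply W x + N x) in
            C1_frechet T \<and>
            ((\<lambda>x. norm (N x) / norm x) \<longlongrightarrow> 0) (at 0) \<and>
            spectral_radius W > 1 \<and>
            exp_asymp_stable_at_0 T \<and>
            (\<forall>\<^sub>F x in at 0.
              (1 / (- ln (norm x))) powr c\<^sub>2 < norm (N x) / norm x \<and>
              norm (N x) / norm x < 4 * (1 / (- ln (norm x))) powr c\<^sub>1)))))"
proof -
  \<comment> \<open>The locale indexes the basis from 0; the midpoint supplies a positive exponent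
    strictly between \<open>c\<^sub>1\<close> and \<open>c\<^sub>2\<close>.\<close>
  define f where "f n = e (Suc n)" for n
  define c where "c = (c\<^sub>1 + c\<^sub>2) / 2"
  have "range f = e ` {1..}"
    by (auto simp: f_def image_iff Suc_le_eq gr0_conv_Suc)
  then interpret kakutani_map f c
    using assms by unfold_locales (auto simp: hilbert_basis_def f_def c_def)
  let ?\<epsilon> = "\<lambda>m. M / K ^ (m - 1)"
  have weights: "kakutani_weights ?\<epsilon> (Suc n) = level (lev n)" for n
    by (simp add: kakutani_weights_def level_def)
  have "(\<lambda>m. ?\<epsilon> (Suc m)) \<longlonglongrightarrow> 0"
    using tendsto_mult_right_zero[OF LIMSEQ_inverse_realpow_zero[OF K_gt_1], of M]
    by (simp add: divide_inverse)
  then have "?\<epsilon> \<longlonglongrightarrow> 0"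
    by (rule filterlim_sequentially_Suc[THEN iffD1])
  moreover have "?\<epsilon> (m + 1) < ?\<epsilon> m" if "m \<ge> 1" for m
    using that K_gt_1 M_gt_1 by (intro divide_strict_left_mono power_strict_increasing) auto
  ultimately have "strictly_decreasing_to_zero ?\<epsilon>"
    using K_gt_1 M_gt_1 by (simp add: strictly_decreasing_to_zero_def)
  moreover have "weighted_shift e (kakutani_weights ?\<epsilon>) W"
    unfolding weighted_shift_def
  proof
    have "{1..} = range Suc"
      by (auto simp: image_iff Suc_le_eq gr0_conv_Suc)
    then have "kakutani_weights ?\<epsilon> ` {1..} = range (\<lambda>n. level (lev n))"
      by (simp only: image_image weights)
    then show "bounded (kakutani_weights ?\<epsilon> ` {1..})"
      using bounded_levels by simp
    show "\<forall>n\<ge>1. W (e n) = kakutani_weights ?\<epsilon> n *\<^sub>R e (n + 1)"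
    proof (intro allI impI)
      fix n :: nat
      assume "n \<ge> 1"
      then obtain k where "n = Suc k"
        by (cases n) auto
      moreover have "W (e (Suc k)) = kakutani_weights ?\<epsilon> (Suc k) *\<^sub>R e (Suc k + 1)"
        using wshift_basis[OF bounded_levels, of k] unfolding weights by (simp add: W_def f_def)
      ultimately show "W (e n) = kakutani_weights ?\<epsilon> n *\<^sub>R e (n + 1)"
        by (simp only:)
    qed
  qed
  moreover have "N 0 = 0"
    by (simp add: N_def blinfun.zero_right)
  moreover have "c\<^sub>1 < c" "c < c\<^sub>2"
    using assms by (simp_all add: c_def)
  moreover have "(\<lambda>x. W x + N x) = T"
    by (simp add: T_def fun_eq_iff)
  ultimately show ?thesis
    unfolding Let_def
    using K_gt_1 M_gt_K T_C1 N_small spectral_radius_W T_stable N_asymp[of c\<^sub>1 c\<^sub>2]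
    by (intro exI[of _ M] exI[of _ K] conjI exI[of _ W] exI[of _ N]) simp_all
qed

end
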